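(* Fix one of the twelve cases (1)–(12) below, and let $A=(a_{ij})$, $B=(b_{ij})$ be real $2\times2$ payoff tables satisfying the equations of that case and otherwise generic (i.e. lying outside some proper Zariski-closed subset of the real variety of payoff pairs defined by the equations of that case). Then every irreducible component of the Spohn variety $\mathcal V_X\subset\mathbb P^3_{\mathbb C}$ contains a smooth point with real coordinates; consequently, the set of real points of $\mathcal V_X$ is Zariski dense in $\mathcal V_X$. The cases are: (1) $a_{11}=a_{12}$; (2) $a_{11}=a_{21}$; (3) $a_{21}=a_{22}$; (4) $b_{11}=b_{12}$; (5) $b_{11}=b_{21}$; (6) $b_{12}=b_{22}$; (7) $a_{12}=a_{22}$ and $b_{21}=b_{22}$; (8) $a_{12}=a_{21}$ and $b_{12}=b_{21}$; (9) $0=a_{12}(b_{12}-b_{22})+a_{21}(b_{22}-b_{21})+a_{22}(b_{21}-b_{12})=a_{11}(b_{22}-b_{12})+a_{21}(b_{11}-b_{22})+a_{22}(b_{12}-b_{11})=a_{11}(b_{22}-b_{21})+a_{12}(b_{11}-b_{22})+a_{22}(b_{21}-b_{11})$; (10) $0=a_{11}(b_{12}-b_{21})+a_{12}(b_{21}-b_{22})+a_{21}(b_{22}-b_{12})=a_{12}(b_{11}-b_{21})+a_{21}(b_{12}-b_{11})+a_{22}(b_{21}-b_{12})=a_{11}(b_{11}-b_{21})+a_{21}(b_{22}-b_{11})+a_{22}(b_{21}-b_{22})$; (11) $0=a_{12}(b_{22}-b_{21})+a_{21}(b_{12}-b_{22})+a_{22}(b_{21}-b_{12})=a_{11}(b_{22}-b_{21})+a_{21}(b_{11}-b_{22})+a_{22}(b_{21}-b_{11})=a_{11}(b_{22}-b_{12})+a_{12}(b_{11}-b_{22})+a_{22}(b_{12}-b_{11})$;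 (12) $0=a_{11}(b_{12}-b_{21})+a_{12}(b_{22}-b_{12})+a_{21}(b_{21}-b_{22})=a_{12}(b_{11}-b_{12})+a_{21}(b_{21}-b_{11})+a_{22}(b_{12}-b_{21})=a_{11}(b_{11}-b_{21})+a_{12}(b_{22}-b_{12})+a_{21}(b_{21}-b_{11})+a_{22}(b_{12}-b_{22})$.
   Context: For a $2\times2$ game $X$ with payoff tables $A=(a_{ij})$ (player 1) and $B=(b_{ij})$ (player 2), the Spohn variety is $\mathcal V_X=\mathbb V(\det M_1,\det M_2)\subset\mathbb P^3_{\mathbb C}$ with homogeneous coordinates $[p_{11}:p_{12}:p_{21}:p_{22}]$, where $\det M_1=(a_{21}-a_{11})p_{11}p_{21}+(a_{22}-a_{11})p_{11}p_{22}+(a_{21}-a_{12})p_{12}p_{21}+(a_{22}-a_{12})p_{12}p_{22}$ and $\det M_2=(b_{12}-b_{11})p_{11}p_{12}+(b_{22}-b_{11})p_{11}p_{22}+(b_{12}-b_{21})p_{12}p_{21}+(b_{22}-b_{21})p_{21}p_{22}$ (these are the determinants of $M_1=\begin{bmatrix}p_{11}+p_{12}& a_{11}p_{11}+a_{12}p_{12}\\ p_{21}+p_{22}& a_{21}p_{21}+a_{22}p_{22}\end{bmatrix}$ and $M_2=\begin{bmatrix}p_{11}+p_{21}& b_{11}p_{11}+b_{21}p_{21}\\ p_{12}+p_{22}& b_{12}p_{12}+b_{22}p_{22}\end{bmatrix}$). *)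

theory Defs
  imports "HOL-Analysis.Analysis"
begin

inductive_set polyfun :: "('p \<Rightarrow> 'a::comm_ring_1) set \<Rightarrow> ('p \<Rightarrow> 'a) set"
  for C :: "('p \<Rightarrow> 'a) set" where
  const: "(\<lambda>x. c) \<in> polyfun C"
| coord: "f \<in> C \<Longrightarrow> f \<in> polyfun C"
| add: "f \<in> polyfun C \<Longrightarrow> g \<in> polyfun C \<Longrightarrow> (\<lambda>x. f x + g x) \<in> polyfun C"
| mult: "f \<in> polyfun C \<Longrightarrow> g \<in> polyfun C \<Longrightarrow> (\<lambda>x. f x * g x) \<in> polyfun C"

definition zclosed :: "('p \<Rightarrow> 'a::comm_ring_1) set \<Rightarrow> 'p set \<Rightarrow> bool" where
  "zclosed C S \<longleftrightarrow> (\<exists>F \<subseteq> polyfun C. S = {x. \<forall>f\<in>F. f x = 0})"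

definition zirred :: "('p \<Rightarrow> 'a::comm_ring_1) set \<Rightarrow> 'p set \<Rightarrow> bool" where
  "zirred C S \<longleftrightarrow> S \<noteq> {} \<and>
     (\<forall>Z1 Z2. zclosed C Z1 \<and> zclosed C Z2 \<and> S \<subseteq> Z1 \<union> Z2 \<longrightarrow> S \<subseteq> Z1 \<or> S \<subseteq> Z2)"

definition vanishing_ideal :: "('p \<Rightarrow> 'a::comm_ring_1) set \<Rightarrow> 'p set \<Rightarrow> ('p \<Rightarrow> 'a) set" where
  "vanishing_ideal C V = {f \<in> polyfun C. \<forall>x\<in>V. f x = 0}"

definition local_dim :: "('p \<Rightarrow> 'a::comm_ring_1) set \<Rightarrow> 'p set \<Rightarrow> 'p \<Rightarrow> nat" where
  "local_dim C V p = Sup {n. \<exists>Y :: nat \<Rightarrow> 'p set.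
      (\<forall>i\<le>n. Y i \<subseteq> V \<and> zclosed C (Y i) \<and> zirred C (Y i)) \<and>
      (\<forall>i<n. Y i \<subset> Y (Suc i)) \<and> p \<in> Y 0}"

text \<open>Coordinates on C^4; we use the indices 1,2,3,4 of type 4 for p11, p12, p21, p22.\<close>
definition coords4 :: "(complex^4 \<Rightarrow> complex) set" where
  "coords4 = range (\<lambda>i p. p $ i)"

definition tangent_space :: "(complex^4) set \<Rightarrow> complex^4 \<Rightarrow> (complex^4) set" where
  "tangent_space V p =
     {v. \<forall>f\<in>vanishing_ideal coords4 V. deriv (\<lambda>t. f (p + t *s v)) 0 = 0}"

text \<open>Smooth (nonsingular) point of an affine variety V in C^4: the (complex) dimension of
  the Zariski tangent space equals the local dimension of V at p (regularity of the local ring).\<close>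
definition smooth_at4 :: "(complex^4) set \<Rightarrow> complex^4 \<Rightarrow> bool" where
  "smooth_at4 V p \<longleftrightarrow> p \<in> V \<and> vec.dim (tangent_space V p) = local_dim coords4 V p"

definition proj_class :: "complex^4 \<Rightarrow> (complex^4) set" where
  "proj_class p = {c *s p | c. c \<noteq> 0}"

definition P3 :: "(complex^4) set set" where
  "P3 = {proj_class p | p. p \<noteq> 0}"

text \<open>Zariski closed subsets of P^3: sets of points whose affine cone is Zariski closed.\<close>
definition pclosed :: "(complex^4) set set \<Rightarrow> bool" where
  "pclosed X \<longleftrightarrow> X \<subseteq> P3 \<and> zclosed coords4 (insert 0 (\<Union>X))"

definition pirred :: "(complex^4) set set \<Rightarrow> bool" where
  "pirred X \<longleftrightarrow> X \<noteq> {} \<and>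
     (\<forall>X1 X2. pclosed X1 \<and> pclosed X2 \<and> X \<subseteq> X1 \<union> X2 \<longrightarrow> X \<subseteq> X1 \<or> X \<subseteq> X2)"

definition pcomponent :: "(complex^4) set set \<Rightarrow> (complex^4) set set \<Rightarrow> bool" where
  "pcomponent V Y \<longleftrightarrow> Y \<subseteq> V \<and> pclosed Y \<and> pirred Y \<and>
     (\<forall>Y'. Y \<subseteq> Y' \<and> Y' \<subseteq> V \<and> pclosed Y' \<and> pirred Y' \<longrightarrow> Y' = Y)"

definition pclosure :: "(complex^4) set set \<Rightarrow> (complex^4) set set" where
  "pclosure S = \<Inter>{X. pclosed X \<and> S \<subseteq> X}"

definition real_ppoint :: "(complex^4) set \<Rightarrow> bool" where
  "real_ppoint x \<longleftrightarrow> (\<exists>p\<in>x. \<forall>i. p $ i \<in> \<real>)"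

definition psmooth :: "(complex^4) set set \<Rightarrow> (complex^4) set \<Rightarrow> bool" where
  "psmooth V x \<longleftrightarrow> x \<in> V \<and> (\<forall>p\<in>x. smooth_at4 (insert 0 (\<Union>V)) p)"

definition detM1 :: "real^2^2 \<Rightarrow> complex^4 \<Rightarrow> complex" where
  "detM1 A p = (let a11 = complex_of_real (A$1$1); a12 = complex_of_real (A$1$2);
                    a21 = complex_of_real (A$2$1); a22 = complex_of_real (A$2$2);
                    p11 = p$1; p12 = p$2; p21 = p$3; p22 = p$4 in
     (a21 - a11) * p11 * p21 + (a22 - a11) * p11 * p22
   + (a21 - a12) * p12 * p21 + (a22 - a12) * p12 * p22)"

definition detM2 :: "real^2^2 \<Rightarrow> complex^4 \<Rightarrow> complex" where
  "detM2 B p = (let b11 = complex_of_real (B$1$1); b12 = complex_of_real (B$1$2);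
                    b21 = complex_of_real (B$2$1); b22 = complex_of_real (B$2$2);
                    p11 = p$1; p12 = p$2; p21 = p$3; p22 = p$4 in
     (b12 - b11) * p11 * p12 + (b22 - b11) * p11 * p22
   + (b12 - b21) * p12 * p21 + (b22 - b21) * p21 * p22)"

definition spohn_variety :: "real^2^2 \<Rightarrow> real^2^2 \<Rightarrow> (complex^4) set set" where
  "spohn_variety A B =
     {proj_class p | p. p \<noteq> 0 \<and> detM1 A p = 0 \<and> detM2 B p = 0}"

definition payoff_coords :: "((real^2^2) \<times> (real^2^2) \<Rightarrow> real) set" where
  "payoff_coords = (\<lambda>(i,j) (A,B). A$i$j) ` UNIV \<union> (\<lambda>(i,j) (A,B). B$i$j) ` UNIV"

definition spohn_case :: "nat \<Rightarrow> real^2^2 \<Rightarrow> real^2^2 \<Rightarrow> bool" where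
  "spohn_case k A B = (let
      a11 = A$1$1; a12 = A$1$2; a21 = A$2$1; a22 = A$2$2;
      b11 = B$1$1; b12 = B$1$2; b21 = B$2$1; b22 = B$2$2 in
    (k = 1 \<and> a11 = a12) \<or>
    (k = 2 \<and> a11 = a21) \<or>
    (k = 3 \<and> a21 = a22) \<or>
    (k = 4 \<and> b11 = b12) \<or>
    (k = 5 \<and> b11 = b21) \<or>
    (k = 6 \<and> b12 = b22) \<or>
    (k = 7 \<and> a12 = a22 \<and> b21 = b22) \<or>
    (k = 8 \<and> a12 = a21 \<and> b12 = b21) \<or>
    (k = 9 \<and> a12*(b12-b22) + a21*(b22-b21) + a22*(b21-b12) = 0
            \<and> a11*(b22-b12) + a21*(b11-b22) + a22*(b12-b11) = 0
            \<and> a11*(b22-b21) + a12*(b11-b22) + a22*(b21-b11) = 0) \<or>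
    (k = 10 \<and> a11*(b12-b21) + a12*(b21-b22) + a21*(b22-b12) = 0
            \<and> a12*(b11-b21) + a21*(b12-b11) + a22*(b21-b12) = 0
            \<and> a11*(b11-b21) + a21*(b22-b11) + a22*(b21-b22) = 0) \<or>
    (k = 11 \<and> a12*(b22-b21) + a21*(b12-b22) + a22*(b21-b12) = 0
            \<and> a11*(b22-b21) + a21*(b11-b22) + a22*(b21-b11) = 0
            \<and> a11*(b22-b12) + a12*(b11-b22) + a22*(b12-b11) = 0) \<or>
    (k = 12 \<and> a11*(b12-b21) + a12*(b22-b12) + a21*(b21-b22) = 0
            \<and> a12*(b11-b12) + a21*(b21-b11) + a22*(b12-b21) = 0
            \<and> a11*(b11-b21) + a12*(b22-b12) + a21*(b21-b11) + a22*(b12-b22) = 0))"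

definition case_variety :: "nat \<Rightarrow> ((real^2^2) \<times> (real^2^2)) set" where
  "case_variety k = {(A,B). spohn_case k A B}"

end

theory Submission
  imports Defs "HOL-Computational_Algebra.Polynomial"
begin

text \<open>
  In each of the twelve cases the affine cone over the Spohn variety is, for generic payoffs, the union of the
  images of finitely many maps from \<open>\<complex>\<^sup>2\<close> given by real binary forms: cones over lines, conics and twisted cubics.
  Such an image is irreducible, and since the real plane is Zariski dense in \<open>\<complex>\<^sup>2\<close>, its real points are dense in it.
  Its dimension is at most two, because functions cutting out a longer chain of irreducible closed sets would be
  algebraically independent, while any three polynomials in two variables are algebraically dependent. Hence a real
  point of the image is smooth as soon as the differentials of the two quadrics are independent there.

  The pair of quadrics degenerates in three ways: a member of the pencil splits into two planes
  (cases 1, 3, 5, 6, 9, 10), both quadrics contain a common line with a residual twisted cubic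
  (cases 2, 4, 8, 11, 12), or two common lines with a residual conic (case 7).
\<close>

section \<open>Polynomial functions and the Zariski topology\<close>

text \<open>Two general quadrics in projective 3-space meet in a curve of genus one, which has no
  rational parametrization; the method lives on the equations of each case breaking this curve into
  rational pieces. The residual cubics are rational because a plane through the common line meets
  each quadric in one more line, and in general these two lines meet in a single point. The
  vanishing ideal of the cone is never computed. The tangent space is squeezed instead: the two
  quadrics lie in the ideal, so their differentials bound it from above by two dimensions, while the
  point itself and the velocity of the parametrization give two independent vectors in it.
  Irreducible components have to be closed, so the Zariski closures of the parametrized images stand
  in for the images. Dimension is defined by chains of irreducible closed sets, hence the detour
  through algebraic dependence.\<close>

lemma polyfun_uminus: "f \<in> polyfun C \<Longrightarrow> (\<lambda>x. - f x) \<in> polyfun C"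
  using polyfun.mult[OF polyfun.const[of "-1"], of f] by simp

lemma polyfun_diff: "f \<in> polyfun C \<Longrightarrow> g \<in> polyfun C \<Longrightarrow> (\<lambda>x. f x - g x) \<in> polyfun C"
  using polyfun.add[OF _ polyfun_uminus, of f C g] by simp

lemma polyfun_power: "f \<in> polyfun C \<Longrightarrow> (\<lambda>x. f x ^ n) \<in> polyfun C"
  by (induction n) (auto intro: polyfun.intros)

lemma polyfun_sum:
  "(\<And>i. i \<in> I \<Longrightarrow> f i \<in> polyfun C) \<Longrightarrow> (\<lambda>x. \<Sum>i\<in>I. f i x) \<in> polyfun C"
  by (induction I rule: infinite_finite_induct) (auto intro: polyfun.intros)

lemmas polyfun_intros =
  polyfun.const polyfun.add polyfun.mult polyfun_uminus polyfun_diff polyfun_power polyfun_sum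

lemma polyfun_compose:
  assumes "f \<in> polyfun C" and "\<And>u. u \<in> C \<Longrightarrow> (\<lambda>x. u (\<phi> x)) \<in> polyfun D"
  shows "(\<lambda>x. f (\<phi> x)) \<in> polyfun D"
  using assms(1) by induction (auto intro: polyfun.intros assms(2))

lemma polyfun_coords4: "(\<lambda>p. p $ i) \<in> polyfun coords4"
  by (rule polyfun.coord) (auto simp: coords4_def)

lemma polyfun_compose4:
  assumes "f \<in> polyfun coords4" and "\<And>i. (\<lambda>x. \<phi> x $ i) \<in> polyfun D"
  shows "(\<lambda>x. f (\<phi> x)) \<in> polyfun D"
  using assms(1) by (rule polyfun_compose) (auto simp: coords4_def assms(2))

text \<open>This is the Zariski closure of \<open>S\<close>.\<close>

definition zhull :: "('p \<Rightarrow> 'a::comm_ring_1) set \<Rightarrow> 'p set \<Rightarrow> 'p set" where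
  "zhull C S = {x. \<forall>f\<in>vanishing_ideal C S. f x = 0}"

lemma zclosed_zhull: "zclosed C (zhull C S)"
  unfolding zclosed_def zhull_def by (rule exI[of _ "vanishing_ideal C S"]) (auto simp: vanishing_ideal_def)

lemma subset_zhull: "S \<subseteq> zhull C S"
  by (auto simp: zhull_def vanishing_ideal_def)

lemma zhull_minimal: "zclosed C Z \<Longrightarrow> S \<subseteq> Z \<Longrightarrow> zhull C S \<subseteq> Z"
  by (fastforce simp: zclosed_def zhull_def vanishing_ideal_def)

lemma zclosed_zero_set: "f \<in> polyfun C \<Longrightarrow> zclosed C {x. f x = 0}"
  unfolding zclosed_def by (rule exI[of _ "{f}"]) auto

lemma zclosed_Int: "zclosed C S \<Longrightarrow> zclosed C T \<Longrightarrow> zclosed C (S \<inter> T)"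
  unfolding zclosed_def
proof (elim exE conjE)
  fix F G assume "F \<subseteq> polyfun C" "S = {x. \<forall>f\<in>F. f x = 0}" "G \<subseteq> polyfun C" "T = {x. \<forall>f\<in>G. f x = 0}"
  then show "\<exists>F\<subseteq>polyfun C. S \<inter> T = {x. \<forall>f\<in>F. f x = 0}"
    by (intro exI[of _ "F \<union> G"]) auto
qed

lemma zclosed_Un:
  fixes C :: "('p \<Rightarrow> 'a::idom) set"
  assumes "zclosed C S" "zclosed C T" shows "zclosed C (S \<union> T)"
proof -
  obtain F G where F: "F \<subseteq> polyfun C" "S = {x. \<forall>f\<in>F. f x = 0}"
    and G: "G \<subseteq> polyfun C" "T = {x. \<forall>f\<in>G. f x = 0}"
    using assms by (auto simp: zclosed_def)
  have "S \<union> T = {x. \<forall>h\<in>{\<lambda>x. f x * g x | f g. f \<in> F \<and> g \<in> G}. h x = 0}"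
    unfolding F(2) G(2) by auto (metis mult_eq_0_iff)
  moreover have "{\<lambda>x. f x * g x | f g. f \<in> F \<and> g \<in> G} \<subseteq> polyfun C"
    using F(1) G(1) by (auto intro: polyfun.mult)
  ultimately show ?thesis unfolding zclosed_def by blast
qed

text \<open>On an irreducible set the polynomial functions form an integral domain; this is the form
  in which irreducibility serves to cancel factors.\<close>

lemma zirred_mult_eq_0:
  assumes "zirred C Y" "f \<in> polyfun C" "g \<in> polyfun C" "\<And>x. x \<in> Y \<Longrightarrow> f x * g x = (0::'a::idom)"
  shows "(\<forall>x\<in>Y. f x = 0) \<or> (\<forall>x\<in>Y. g x = 0)"
proof -
  have "Y \<subseteq> {x. f x = 0} \<union> {x. g x = 0}" using assms(4) by auto
  with assms(1-3) zclosed_zero_set have "Y \<subseteq> {x. f x = 0} \<or> Y \<subseteq> {x. g x = 0}"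
    unfolding zirred_def by blast
  then show ?thesis by auto
qed

lemma zirred_zhull:
  assumes "zirred C S" shows "zirred C (zhull C S)"
  unfolding zirred_def
proof (intro conjI allI impI)
  show "zhull C S \<noteq> {}" using assms subset_zhull[of S C] by (auto simp: zirred_def)
next
  fix Z1 Z2 assume *: "zclosed C Z1 \<and> zclosed C Z2 \<and> zhull C S \<subseteq> Z1 \<union> Z2"
  then have "S \<subseteq> Z1 \<union> Z2" using subset_zhull[of S C] by auto
  with * assms have "S \<subseteq> Z1 \<or> S \<subseteq> Z2" by (auto simp: zirred_def)
  then show "zhull C S \<subseteq> Z1 \<or> zhull C S \<subseteq> Z2" using * zhull_minimal[of C] by blast
qed

lemma zirred_finite_cover:
  fixes C :: "('p \<Rightarrow> 'a::idom) set"
  assumes "finite I" "zirred C Y" "\<And>i. i \<in> I \<Longrightarrow> zclosed C (Z i)" "Y \<subseteq> (\<Union>i\<in>I. Z i)"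
  shows "\<exists>i\<in>I. Y \<subseteq> Z i"
  using assms(1,3,4)
proof (induction I)
  case empty
  then show ?case using assms(2) by (auto simp: zirred_def)
next
  case (insert i I)
  have "zclosed C (\<Union>i\<in>I. Z i)" using \<open>finite I\<close> insert.prems(1)
  proof (induction I)
    case empty
    then show ?case using zclosed_zero_set[OF polyfun.const[of 1 C]] by simp
  qed (auto intro: zclosed_Un)
  then have "Y \<subseteq> Z i \<or> Y \<subseteq> (\<Union>i\<in>I. Z i)"
    using assms(2) insert.prems unfolding zirred_def by (metis UN_insert insertI1)
  then show ?case using insert by auto
qed

section \<open>Polynomial functions of two variables and images of the plane\<close>

definition coords2 :: "(complex \<times> complex \<Rightarrow> complex) set" where
  "coords2 = {fst, snd}"

lemma polyfun_fst: "(\<lambda>x. fst x) \<in> polyfun coords2" and polyfun_snd: "(\<lambda>x. snd x) \<in> polyfun coords2"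
  by (auto simp: coords2_def intro: polyfun.coord)

text \<open>Iterated univariate polynomials make root counting available in each variable: the outer
  variable is \<open>s\<close>, evaluated at the constant polynomial \<open>[:s:]\<close>, and the
  coefficients are polynomials in \<open>t\<close>.\<close>

lemma polyfun_coords2_poly:
  assumes "f \<in> polyfun coords2"
  shows "\<exists>P :: complex poly poly. \<forall>s t. f (s, t) = poly (poly P [:s:]) t"
  using assms
proof induction
  case (const c)
  show ?case by (rule exI[of _ "[:[:c:]:]"]) simp
next
  case (coord f)
  then consider "f = fst" | "f = snd" by (auto simp: coords2_def)
  then show ?case
    by cases (rule exI[of _ "[:0, 1:]"], simp, rule exI[of _ "[:[:0, 1:]:]"], simp)
next
  case (add f g)
  then obtain P Q where "\<forall>s t. f (s, t) = poly (poly P [:s:]) t" "\<forall>s t. g (s, t) = poly (poly Q [:s:]) t" by blast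
  then show ?case by (intro exI[of _ "P + Q"]) simp
next
  case (mult f g)
  then obtain P Q where "\<forall>s t. f (s, t) = poly (poly P [:s:]) t" "\<forall>s t. g (s, t) = poly (poly Q [:s:]) t" by blast
  then show ?case by (intro exI[of _ "P * Q"]) simp
qed

text \<open>For fixed \<open>s\<close> in \<open>A\<close>, infinitely many roots \<open>t\<close>
  kill \<open>poly P [:s:]\<close>; then \<open>P\<close> itself has infinitely many roots
  \<open>[:s:]\<close>. The grid over \<open>A\<close> serves both the real plane and the whole
  plane.\<close>

lemma poly2_eq_0:
  fixes P :: "complex poly poly"
  assumes "infinite A" "\<And>s t. s \<in> A \<Longrightarrow> t \<in> A \<Longrightarrow> poly (poly P [:s:]) t = 0"
  shows "P = 0"
proof (rule ccontr)
  assume "P \<noteq> 0"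
  have "poly P [:s:] = 0" if "s \<in> A" for s
  proof (rule ccontr)
    assume "poly P [:s:] \<noteq> 0"
    then have "finite {t. poly (poly P [:s:]) t = 0}" by (rule poly_roots_finite)
    moreover have "A \<subseteq> {t. poly (poly P [:s:]) t = 0}" using assms(2) that by auto
    ultimately show False using assms(1) finite_subset by blast
  qed
  then have "(\<lambda>s. [:s:]) ` A \<subseteq> {q. poly P q = 0}" by auto
  moreover have "finite {q. poly P q = 0}" using \<open>P \<noteq> 0\<close> by (rule poly_roots_finite)
  ultimately have "finite ((\<lambda>s. [:s:]) ` A)" by (rule finite_subset)
  moreover have "inj_on (\<lambda>s. [:s:]) A" by (auto simp: inj_on_def)
  ultimately show False using assms(1) finite_imageD by blast
qed

lemma infinite_complex_Reals: "infinite (\<real> :: complex set)"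
proof -
  have "inj complex_of_real" by (auto simp: inj_def)
  then have "infinite (range complex_of_real)"
    by (simp add: finite_image_iff infinite_UNIV_char_0)
  then show ?thesis by (simp add: Reals_def)
qed

text \<open>Zariski density of the real plane, the source of the density of real points in every
  parametrized image.\<close>

lemma polyfun_coords2_real_zero:
  assumes "f \<in> polyfun coords2" "\<And>s t. s \<in> \<real> \<Longrightarrow> t \<in> \<real> \<Longrightarrow> f (s, t) = 0"
  shows "f x = 0"
proof -
  obtain P where P: "\<forall>s t. f (s, t) = poly (poly P [:s:]) t" using polyfun_coords2_poly[OF assms(1)] by blast
  have "P = 0" using poly2_eq_0[OF infinite_complex_Reals] P assms(2) by metis
  with P show ?thesis by (cases x) simp
qed

lemma polyfun_coords2_mult_zero:
  assumes "f \<in> polyfun coords2" "g \<in> polyfun coords2" "\<And>x. f x * g x = 0"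
  shows "(\<forall>x. f x = 0) \<or> (\<forall>x. g x = 0)"
proof -
  obtain P where P: "\<forall>s t. f (s, t) = poly (poly P [:s:]) t" using polyfun_coords2_poly[OF assms(1)] by blast
  obtain Q where Q: "\<forall>s t. g (s, t) = poly (poly Q [:s:]) t" using polyfun_coords2_poly[OF assms(2)] by blast
  have "P * Q = 0"
  proof (rule poly2_eq_0[OF infinite_UNIV_char_0])
    fix s t :: complex
    show "poly (poly (P * Q) [:s:]) t = 0" using assms(3)[of "(s, t)"] P Q by simp
  qed
  then have "P = 0 \<or> Q = 0" by simp
  with P Q show ?thesis by auto
qed

definition polymap :: "(complex \<times> complex \<Rightarrow> complex^4) \<Rightarrow> bool" where
  "polymap \<phi> \<longleftrightarrow> (\<forall>i. (\<lambda>x. \<phi> x $ i) \<in> polyfun coords2)"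

lemma polymap_compose:
  "polymap \<phi> \<Longrightarrow> f \<in> polyfun coords4 \<Longrightarrow> (\<lambda>x. f (\<phi> x)) \<in> polyfun coords2"
  by (simp add: polymap_def polyfun_compose4)

text \<open>Pulled back along \<open>\<phi>\<close>, the claim reduces to the absence of zero
  divisors among polynomial functions on the plane.\<close>

lemma zirred_range_polymap:
  assumes "polymap \<phi>" shows "zirred coords4 (range \<phi>)"
  unfolding zirred_def
proof (intro conjI allI impI)
  show "range \<phi> \<noteq> {}" by simp
next
  fix Z1 Z2 assume Z: "zclosed coords4 Z1 \<and> zclosed coords4 Z2 \<and> range \<phi> \<subseteq> Z1 \<union> Z2"
  then obtain F G where F: "F \<subseteq> polyfun coords4" "Z1 = {x. \<forall>f\<in>F. f x = 0}"
    and G: "G \<subseteq> polyfun coords4" "Z2 = {x. \<forall>f\<in>G. f x = 0}"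
    by (auto simp: zclosed_def)
  show "range \<phi> \<subseteq> Z1 \<or> range \<phi> \<subseteq> Z2"
  proof (rule ccontr)
    assume "\<not> (range \<phi> \<subseteq> Z1 \<or> range \<phi> \<subseteq> Z2)"
    then obtain x y f g where fg: "f \<in> F" "f (\<phi> x) \<noteq> 0" "g \<in> G" "g (\<phi> y) \<noteq> 0"
      unfolding F(2) G(2) by blast
    have "f (\<phi> z) * g (\<phi> z) = 0" for z using Z fg unfolding F(2) G(2) by auto
    then show False
      using polyfun_coords2_mult_zero[of "\<lambda>x. f (\<phi> x)" "\<lambda>x. g (\<phi> x)"] fg F(1) G(1) polymap_compose[OF assms]
      by blast
  qed
qed

section \<open>Algebraic dependence of three polynomials in two variables\<close>

lemma homogeneous_system_nontrivial:
  fixes m :: "'k \<Rightarrow> 't \<Rightarrow> 'a::field"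
  assumes "finite T" "finite K" "card T < card K"
  shows "\<exists>c. (\<exists>k\<in>K. c k \<noteq> 0) \<and> (\<forall>t\<in>T. (\<Sum>k\<in>K. c k * m k t) = 0)"
  using assms
proof (induction T arbitrary: K m)
  case empty
  then obtain k where "k \<in> K" by fastforce
  then show ?case by (intro exI[of _ "\<lambda>_. 1"]) auto
next
  case (insert t T)
  show ?case
  proof (cases "\<forall>k\<in>K. m k t = 0")
    case True
    have "card T < card K" using insert by simp
    from insert.IH[OF insert.prems(1) this, of m] True show ?thesis by (auto intro!: sum.neutral)
  next
    case False
    then obtain k0 where k0: "k0 \<in> K" "m k0 t \<noteq> 0" by blast
    define K' where "K' = K - {k0}"
    have K: "K = insert k0 K'" "k0 \<notin> K'" "finite K'" using k0 insert.prems by (auto simp: K'_def)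
    have "card T < card K'" using insert.prems insert.hyps K by simp
    from insert.IH[OF K(3) this, of "\<lambda>k u. m k u - m k t / m k0 t * m k0 u"]
    obtain c where c: "\<exists>k\<in>K'. c k \<noteq> 0"
      "\<And>u. u \<in> T \<Longrightarrow> (\<Sum>k\<in>K'. c k * (m k u - m k t / m k0 t * m k0 u)) = 0" by blast
    \<comment> \<open>The other unknowns solve the system from which equation \<open>t\<close> has
      been eliminated with pivot \<open>k0\<close>; the unknown at \<open>k0\<close> is now set so
      that equation \<open>t\<close> holds.\<close>
    define z where "z = - (\<Sum>k\<in>K'. c k * m k t) / m k0 t"
    define c' where "c' = c(k0 := z)"
    have eq: "(\<Sum>k\<in>K. c' k * m k u) = z * m k0 u + (\<Sum>k\<in>K'. c k * m k u)" for u
    proof -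
      have "(\<Sum>k\<in>K'. c' k * m k u) = (\<Sum>k\<in>K'. c k * m k u)"
        using K(2) by (intro sum.cong) (auto simp: c'_def)
      then show ?thesis using K by (simp add: c'_def)
    qed
    have "(\<Sum>k\<in>K. c' k * m k u) = 0" if "u \<in> T" for u
    proof -
      have "(\<Sum>k\<in>K'. c k * (m k u - m k t / m k0 t * m k0 u))
        = (\<Sum>k\<in>K'. c k * m k u) - (\<Sum>k\<in>K'. c k * m k t * (m k0 u / m k0 t))"
        by (simp add: right_diff_distrib sum_subtractf mult.assoc)
      also have "\<dots> = (\<Sum>k\<in>K. c' k * m k u)"
        unfolding eq z_def sum_distrib_right[symmetric] by simp
      finally show ?thesis using c(2)[OF that] by simp
    qed
    moreover have "(\<Sum>k\<in>K. c' k * m k t) = 0" unfolding eq z_def using k0(2) by simp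
    moreover have "\<exists>k\<in>K. c' k \<noteq> 0" using c(1) K by (auto simp: c'_def)
    ultimately show ?thesis by blast
  qed
qed

text \<open>A square box of exponents in place of the total degree: it holds
  \<open>(n + 1)^2\<close> monomials, and its side adds up under multiplication.\<close>

definition bidegree_le :: "'a::comm_ring_1 poly poly \<Rightarrow> nat \<Rightarrow> bool" where
  "bidegree_le P n \<longleftrightarrow> degree P \<le> n \<and> (\<forall>i. degree (coeff P i) \<le> n)"

lemma bidegree_le_exists: "\<exists>n. bidegree_le P n"
proof -
  define n where "n = Max (insert (degree P) ((\<lambda>i. degree (coeff P i)) ` {..degree P}))"
  have "degree P \<le> n" unfolding n_def by (intro Max_ge) auto
  moreover have "degree (coeff P i) \<le> n" for i
  proof (cases "i \<le> degree P")
    case True then show ?thesis unfolding n_def by (intro Max_ge) auto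
  qed (simp add: coeff_eq_0)
  ultimately show ?thesis by (auto simp: bidegree_le_def)
qed

lemma bidegree_le_mono: "bidegree_le P m \<Longrightarrow> m \<le> n \<Longrightarrow> bidegree_le P n"
  unfolding bidegree_le_def using order_trans by blast

lemma bidegree_le_mult:
  assumes "bidegree_le P m" "bidegree_le Q n"
  shows "bidegree_le (P * Q) (m + n)"
  unfolding bidegree_le_def
proof (intro conjI allI)
  show "degree (P * Q) \<le> m + n"
    using assms degree_mult_le[of P Q] by (force simp: bidegree_le_def)
  fix i
  show "degree (coeff (P * Q) i) \<le> m + n"
    unfolding coeff_mult
  proof (rule degree_sum_le)
    fix j
    show "degree (coeff P j * coeff Q (i - j)) \<le> m + n"
      using assms degree_mult_le[of "coeff P j" "coeff Q (i - j)"]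
      by (meson add_mono bidegree_le_def order_trans)
  qed simp
qed

lemma bidegree_le_power: "bidegree_le P n \<Longrightarrow> bidegree_le (P ^ k) (k * n)"
  by (induction k) (auto simp: bidegree_le_mult, auto simp: bidegree_le_def)

text \<open>There are \<open>(M + 1)\<^sup>3\<close> products of powers with exponents up to \<open>M\<close>, but the space of
  bivariate polynomials containing them has dimension quadratic in \<open>M\<close>.\<close>

lemma three_polyfuns_dependent:
  assumes "f1 \<in> polyfun coords2" "f2 \<in> polyfun coords2" "f3 \<in> polyfun coords2"
  shows "\<exists>(M::nat) k. (\<exists>a\<le>M. \<exists>b\<le>M. \<exists>c\<le>M. k a b c \<noteq> 0) \<and>
    (\<forall>x. (\<Sum>c\<le>M. (\<Sum>b\<le>M. (\<Sum>a\<le>M. k a b c * f1 x ^ a) * f2 x ^ b) * f3 x ^ c) = 0)"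
proof -
  obtain P1 where P1: "\<And>s t. f1 (s, t) = poly (poly P1 [:s:]) t" using polyfun_coords2_poly[OF assms(1)] by blast
  obtain P2 where P2: "\<And>s t. f2 (s, t) = poly (poly P2 [:s:]) t" using polyfun_coords2_poly[OF assms(2)] by blast
  obtain P3 where P3: "\<And>s t. f3 (s, t) = poly (poly P3 [:s:]) t" using polyfun_coords2_poly[OF assms(3)] by blast
  obtain d1 d2 d3 where "bidegree_le P1 d1" "bidegree_le P2 d2" "bidegree_le P3 d3"
    using bidegree_le_exists by metis
  then obtain d where d: "bidegree_le P1 d" "bidegree_le P2 d" "bidegree_le P3 d"
    using bidegree_le_mono[of _ _ "d1 + d2 + d3"] by (metis le_add1 le_add2 trans_le_add1)
  \<comment> \<open>Chosen so that \<open>(D + 1)^2 \<le> (3 * d + 1)^2 * (M + 1)^2 = M * (M + 1)^2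
    < (M + 1)^3\<close>: fewer coefficient equations than products of powers.\<close>
  define M where "M = (3 * d + 1)\<^sup>2"
  define D where "D = 3 * M * d"
  define F where "F = (\<lambda>(a, b, c). P1 ^ a * P2 ^ b * P3 ^ c)"
  define K where "K = {..M} \<times> {..M} \<times> {..M}"
  have F: "bidegree_le (F k) D" if kK: "k \<in> K" for k
  proof -
    obtain a b c where k: "k = (a, b, c)" "a \<le> M" "b \<le> M" "c \<le> M" using kK
      by (auto simp: K_def)
    have "bidegree_le (P1 ^ a * P2 ^ b * P3 ^ c) (a * d + b * d + c * d)"
      by (intro bidegree_le_mult bidegree_le_power d)
    moreover have "(a + b + c) * d \<le> (3 * M) * d" by (rule mult_right_mono) (use k in auto)
    then have "a * d + b * d + c * d \<le> D" by (simp add: D_def algebra_simps)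
    ultimately show ?thesis by (auto simp: F_def k intro: bidegree_le_mono)
  qed
  have "(D + 1)\<^sup>2 \<le> ((3 * d + 1) * (M + 1))\<^sup>2"
    by (rule power_mono) (auto simp: D_def algebra_simps)
  also have "\<dots> = M * (M + 1)\<^sup>2" by (simp only: M_def power_mult_distrib)
  also have "\<dots> < (M + 1) ^ 3" by (simp add: power2_eq_square power3_eq_cube)
  finally have "card ({..D} \<times> {..D}) < card K"
    by (simp add: K_def card_cartesian_product power2_eq_square power3_eq_cube algebra_simps)
  from homogeneous_system_nontrivial[OF _ _ this, of "\<lambda>k (i, j). coeff (coeff (F k) i) j"]
  obtain k where k: "\<exists>x\<in>K. k x \<noteq> 0"
    "\<And>i j. i \<le> D \<Longrightarrow> j \<le> D \<Longrightarrow> (\<Sum>x\<in>K. k x * coeff (coeff (F x) i) j) = 0"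
    by (auto simp: K_def)
  have sum_0: "(\<Sum>x\<in>K. smult [:k x:] (F x)) = 0"
  proof (intro poly_eqI)
    fix i j
    have "coeff (coeff (\<Sum>x\<in>K. smult [:k x:] (F x)) i) j = (\<Sum>x\<in>K. k x * coeff (coeff (F x) i) j)"
      by (simp add: coeff_sum)
    also have "\<dots> = 0"
    proof (cases "i \<le> D \<and> j \<le> D")
      case True then show ?thesis using k by auto
    next
      case False
      then have "coeff (coeff (F x) i) j = 0" if "x \<in> K" for x
      proof (cases "i \<le> D")
        case True
        then have "degree (coeff (F x) i) < j" using False F[OF that]
          by (meson bidegree_le_def le_less_trans not_le)
        then show ?thesis by (rule coeff_eq_0)
      next
        case False
        then have "degree (F x) < i" using F[OF that] by (simp add: bidegree_le_def)
        then show ?thesis by (simp add: coeff_eq_0)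
      qed
      then show ?thesis by (auto intro: sum.neutral)
    qed
    finally show "coeff (coeff (\<Sum>x\<in>K. smult [:k x:] (F x)) i) j = coeff (coeff 0 i) j" by simp
  qed
  have *: "(\<Sum>x\<in>K. k x * poly (poly (F x) [:s:]) t) = 0" for s t
  proof -
    have "poly (poly (\<Sum>x\<in>K. smult [:k x:] (F x)) [:s:]) t = (\<Sum>x\<in>K. k x * poly (poly (F x) [:s:]) t)"
      by (simp add: poly_sum)
    with sum_0 show ?thesis by simp
  qed
  have "(\<Sum>c\<le>M. (\<Sum>b\<le>M. (\<Sum>a\<le>M. k (a, b, c) * f1 x ^ a) * f2 x ^ b) * f3 x ^ c) = 0" for x
  proof -
    obtain s t where x: "x = (s, t)" by (cases x)
    have "(\<Sum>c\<le>M. (\<Sum>b\<le>M. (\<Sum>a\<le>M. k (a, b, c) * f1 x ^ a) * f2 x ^ b) * f3 x ^ c)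
      = (\<Sum>c\<le>M. \<Sum>b\<le>M. \<Sum>a\<le>M. k (a, b, c) * poly (poly (F (a, b, c)) [:s:]) t)"
      by (simp add: sum_distrib_right x P1 P2 P3 F_def mult.assoc poly_power)
    also have "\<dots> = (\<Sum>c\<le>M. \<Sum>a\<le>M. \<Sum>b\<le>M. k (a, b, c) * poly (poly (F (a, b, c)) [:s:]) t)"
      by (intro sum.cong refl sum.swap)
    also have "\<dots> = (\<Sum>a\<le>M. \<Sum>c\<le>M. \<Sum>b\<le>M. k (a, b, c) * poly (poly (F (a, b, c)) [:s:]) t)"
      by (rule sum.swap)
    also have "\<dots> = (\<Sum>a\<le>M. \<Sum>b\<le>M. \<Sum>c\<le>M. k (a, b, c) * poly (poly (F (a, b, c)) [:s:]) t)"
      by (intro sum.cong refl sum.swap)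
    also have "\<dots> = 0" using *[of s t] by (simp add: K_def sum.cartesian_product)
    finally show ?thesis .
  qed
  moreover from k(1) obtain a b c where "a \<le> M" "b \<le> M" "c \<le> M" "k (a, b, c) \<noteq> 0" by (auto simp: K_def)
  ultimately show ?thesis by (intro exI[of _ M] exI[of _ "\<lambda>a b c. k (a, b, c)"]) blast
qed

section \<open>Dimension and tangent spaces of parametrized cones\<close>

text \<open>Once the coefficients below \<open>c\<close> vanish on \<open>Y\<close>, the factor
  \<open>g ^ c\<close> cancels by irreducibility; on \<open>Y'\<close>, where \<open>g\<close> is
  zero, only \<open>h c\<close> is left. The hypothesis \<open>sep\<close> carries its vanishing
  from \<open>Y'\<close> back to \<open>Y\<close>.\<close>

lemma zirred_power_sum_zero:
  fixes h :: "nat \<Rightarrow> 'p \<Rightarrow> 'a::idom"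
  assumes Y: "zirred C Y" and Y': "Y' \<subseteq> Y"
    and g: "g \<in> polyfun C" "\<And>x. x \<in> Y' \<Longrightarrow> g x = 0" "\<exists>x\<in>Y. g x \<noteq> 0"
    and h: "\<And>c. h c \<in> polyfun C"
    and sep: "\<And>c. c \<le> M \<Longrightarrow> (\<And>x. x \<in> Y' \<Longrightarrow> h c x = 0) \<Longrightarrow> \<forall>x\<in>Y. h c x = 0"
    and sum: "\<And>x. x \<in> Y \<Longrightarrow> (\<Sum>c\<le>M. h c x * g x ^ c) = 0"
  shows "c \<le> M \<Longrightarrow> \<forall>x\<in>Y. h c x = 0"
proof (induction c rule: less_induct)
  case (less c)
  define r where "r = (\<lambda>x. \<Sum>i\<in>{Suc c..M}. h i x * g x ^ (i - Suc c))"
  have r: "r \<in> polyfun C" unfolding r_def by (intro polyfun_intros h g)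
  have "g x ^ c * (h c x + g x * r x) = 0" if "x \<in> Y" for x
  proof -
    have "{..M} = {..<c} \<union> ({c} \<union> {Suc c..M})" using less.prems by auto
    then have "0 = (\<Sum>i\<in>{..<c} \<union> ({c} \<union> {Suc c..M}). h i x * g x ^ i)" using sum[OF that] by simp
    also have "\<dots> = (\<Sum>i<c. h i x * g x ^ i) + (h c x * g x ^ c + (\<Sum>i\<in>{Suc c..M}. h i x * g x ^ i))"
      by (subst sum.union_disjoint; force?)+
    also have "(\<Sum>i<c. h i x * g x ^ i) = 0" using less that by (intro sum.neutral) auto
    also have "(\<Sum>i\<in>{Suc c..M}. h i x * g x ^ i) = g x ^ c * (g x * r x)"
      unfolding r_def sum_distrib_left
    proof (rule sum.cong[OF refl])
      fix i assume "i \<in> {Suc c..M}"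
      then have "g x ^ i = g x ^ c * g x * g x ^ (i - Suc c)"
        by (metis atLeastAtMost_iff le_add_diff_inverse power_Suc2 power_add)
      then show "h i x * g x ^ i = g x ^ c * (g x * (h i x * g x ^ (i - Suc c)))"
        by (simp add: mult_ac)
    qed
    finally show ?thesis by (simp add: algebra_simps)
  qed
  then have "(\<forall>x\<in>Y. g x ^ c = 0) \<or> (\<forall>x\<in>Y. h c x + g x * r x = 0)"
    by (intro zirred_mult_eq_0[OF Y] polyfun_intros g h r)
  then have "\<forall>x\<in>Y. h c x + g x * r x = 0" using g(3) by auto
  then have "h c x = 0" if "x \<in> Y'" for x using Y' g(2)[OF that] that by fastforce
  then show ?case using sep less.prems by blast
qed

lemma zclosed_separate:
  assumes "zclosed C Y" "Y \<subset> Y'"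
  obtains f where "f \<in> polyfun C" "\<And>x. x \<in> Y \<Longrightarrow> f x = 0" "\<exists>x\<in>Y'. f x \<noteq> 0"
  using assms unfolding zclosed_def by blast

text \<open>Functions \<open>g\<^sub>1, g\<^sub>2, g\<^sub>3\<close> cutting out the successive steps of such a chain would be
  algebraically independent on \<open>Y3\<close>.\<close>

lemma no_chain_of_length_3:
  assumes Y0: "Y0 \<noteq> {}" "zclosed coords4 Y0" and Y1: "zirred coords4 Y1" "zclosed coords4 Y1"
    and Y2: "zirred coords4 Y2" "zclosed coords4 Y2" and Y3: "zirred coords4 Y3"
    and sub: "Y0 \<subset> Y1" "Y1 \<subset> Y2" "Y2 \<subset> Y3"
    and \<phi>: "polymap \<phi>" "Y3 \<subseteq> zhull coords4 (range \<phi>)"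
  shows False
proof -
  obtain g1 where g1: "g1 \<in> polyfun coords4" "\<And>x. x \<in> Y0 \<Longrightarrow> g1 x = 0" "\<exists>x\<in>Y1. g1 x \<noteq> 0"
    using zclosed_separate[OF Y0(2) sub(1)] by blast
  obtain g2 where g2: "g2 \<in> polyfun coords4" "\<And>x. x \<in> Y1 \<Longrightarrow> g2 x = 0" "\<exists>x\<in>Y2. g2 x \<noteq> 0"
    using zclosed_separate[OF Y1(2) sub(2)] by blast
  obtain g3 where g3: "g3 \<in> polyfun coords4" "\<And>x. x \<in> Y2 \<Longrightarrow> g3 x = 0" "\<exists>x\<in>Y3. g3 x \<noteq> 0"
    using zclosed_separate[OF Y2(2) sub(3)] by blast
  obtain M k where k: "\<exists>a\<le>M. \<exists>b\<le>M. \<exists>c\<le>M. k a b c \<noteq> 0"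
    and rel: "\<And>x. (\<Sum>c\<le>M. (\<Sum>b\<le>M. (\<Sum>a\<le>M. k a b c * g1 (\<phi> x) ^ a) * g2 (\<phi> x) ^ b) * g3 (\<phi> x) ^ c) = 0"
    using three_polyfuns_dependent[OF \<phi>(1)[THEN polymap_compose, OF g1(1)]
        \<phi>(1)[THEN polymap_compose, OF g2(1)] \<phi>(1)[THEN polymap_compose, OF g3(1)]] by blast
  \<comment> \<open>The relation is read as a polynomial in \<open>g3\<close> whose coefficients
    \<open>p2 c\<close> are polynomials in \<open>g2\<close>, with coefficients
    \<open>p1 b c\<close> that are polynomials in \<open>g1\<close>. Going down the chain strips off
    one function per step.\<close>
  define p1 where "p1 = (\<lambda>b c x. \<Sum>a\<le>M. k a b c * g1 x ^ a)"
  define p2 where "p2 = (\<lambda>c x. \<Sum>b\<le>M. p1 b c x * g2 x ^ b)"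
  have p1: "p1 b c \<in> polyfun coords4" for b c unfolding p1_def by (intro polyfun_intros g1)
  have p2: "p2 c \<in> polyfun coords4" for c unfolding p2_def by (intro polyfun_intros p1 g2)
  \<comment> \<open>At the bottom the coefficients are constants, and a constant vanishing on the
    nonempty set \<open>Y0\<close> is zero; this supplies \<open>sep\<close>. One level up,
    \<open>sep\<close> comes from \<open>k0\<close>, and at the top from \<open>k1\<close>.\<close>
  have k0: "k a b c = 0" if "\<And>x. x \<in> Y1 \<Longrightarrow> p1 b c x = 0" "a \<le> M" for a b c
  proof -
    have "\<forall>x\<in>Y1. k a b c = 0"
      by (rule zirred_power_sum_zero[where h="\<lambda>a _. k a b c" and M=M, OF Y1(1) _ g1])
        (use sub Y0 that in \<open>auto intro: polyfun.const simp: p1_def\<close>)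
    then show ?thesis using sub by blast
  qed
  have k1: "k a b c = 0" if "\<And>x. x \<in> Y2 \<Longrightarrow> p2 c x = 0" "a \<le> M" "b \<le> M" for a b c
  proof -
    have "\<forall>x\<in>Y2. p1 b c x = 0"
    proof (rule zirred_power_sum_zero[where h="\<lambda>b. p1 b c" and M=M, OF Y2(1) _ g2])
      show "\<forall>x\<in>Y2. p1 b c x = 0" if "\<And>x. x \<in> Y1 \<Longrightarrow> p1 b c x = 0" for b
        using k0[OF that] by (simp add: p1_def)
    qed (use sub that p1 in \<open>auto simp: p2_def\<close>)
    then show ?thesis using k0 sub that by blast
  qed
  have "\<forall>x\<in>Y3. p2 c x = 0" if "c \<le> M" for c
  proof (rule zirred_power_sum_zero[where h=p2 and M=M, OF Y3 _ g3])
    show "\<forall>x\<in>Y3. p2 c x = 0" if "\<And>x. x \<in> Y2 \<Longrightarrow> p2 c x = 0" for c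
      using k1[OF that] by (simp add: p2_def p1_def)
    show "(\<Sum>c\<le>M. p2 c x * g3 x ^ c) = 0" if "x \<in> Y3" for x
    proof -
      have *: "(\<lambda>x. \<Sum>c\<le>M. p2 c x * g3 x ^ c) \<in> vanishing_ideal coords4 (range \<phi>)"
        unfolding vanishing_ideal_def using rel
        by (auto intro!: polyfun_intros g1(1) g2(1) g3(1) simp: p2_def p1_def)
      have "x \<in> zhull coords4 (range \<phi>)" using \<phi>(2) \<open>x \<in> Y3\<close> by (rule subsetD)
      from this[unfolded zhull_def mem_Collect_eq, rule_format, OF *] show ?thesis .
    qed
  qed (use sub that p2 in auto)
  then have "\<And>x. x \<in> Y2 \<Longrightarrow> p2 c x = 0" if "c \<le> M" for c using that sub(3) by blast
  then have "k a b c = 0" if "a \<le> M" "b \<le> M" "c \<le> M" for a b c using that k1 by simp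
  then show False using k by auto
qed

section \<open>Cones and their tangent spaces\<close>

definition is_cone :: "(complex^4) set \<Rightarrow> bool" where
  "is_cone V \<longleftrightarrow> 0 \<in> V \<and> (\<forall>p\<in>V. \<forall>c. c *s p \<in> V)"

lemma polyfun_scale: "f \<in> polyfun coords4 \<Longrightarrow> (\<lambda>p. f (c *s p)) \<in> polyfun coords4"
  by (erule polyfun_compose4) (auto intro!: polyfun_intros polyfun_coords4)

text \<open>\<open>tangent_space\<close> tests functions along straight lines only, so a curve has
  to be compared with its tangent line. Induction over \<open>polyfun\<close> keeps all derivatives
  in one complex variable.\<close>

lemma polyfun_chain_rule:
  fixes \<gamma> :: "complex \<Rightarrow> complex^4"
  assumes "f \<in> polyfun coords4" "\<And>i. ((\<lambda>z. \<gamma> z $ i) has_field_derivative w $ i) (at 0)"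
  shows "\<exists>D. ((\<lambda>z. f (\<gamma> z)) has_field_derivative D) (at 0) \<and>
    ((\<lambda>z. f (\<gamma> 0 + z *s w)) has_field_derivative D) (at 0)"
  using assms(1)
proof induction
  case (const c)
  show ?case by (intro exI[of _ 0]) auto
next
  case (coord f)
  then obtain i where f: "f = (\<lambda>p. p $ i)" by (auto simp: coords4_def)
  show ?case unfolding f using assms(2)[of i]
    by (intro exI[of _ "w $ i"]) (auto intro!: derivative_eq_intros)
next
  case (add f g)
  then obtain D E where "((\<lambda>z. f (\<gamma> z)) has_field_derivative D) (at 0)"
    "((\<lambda>z. f (\<gamma> 0 + z *s w)) has_field_derivative D) (at 0)"
    "((\<lambda>z. g (\<gamma> z)) has_field_derivative E) (at 0)"
    "((\<lambda>z. g (\<gamma> 0 + z *s w)) has_field_derivative E) (at 0)" by blast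
  then show ?case by (intro exI[of _ "D + E"]) (auto intro: DERIV_add)
next
  case (mult f g)
  then obtain D E where "((\<lambda>z. f (\<gamma> z)) has_field_derivative D) (at 0)"
    "((\<lambda>z. f (\<gamma> 0 + z *s w)) has_field_derivative D) (at 0)"
    "((\<lambda>z. g (\<gamma> z)) has_field_derivative E) (at 0)"
    "((\<lambda>z. g (\<gamma> 0 + z *s w)) has_field_derivative E) (at 0)" by blast
  from DERIV_mult[OF this(1,3)] DERIV_mult[OF this(2,4)]
  show ?case by (intro exI[of _ "D * g (\<gamma> 0) + E * f (\<gamma> 0)"]) simp
qed

text \<open>A function in the vanishing ideal is constantly zero along the curve, and its derivative
  along the tangent line is the same number.\<close>

lemma tangent_space_curve:
  assumes "\<And>z. \<gamma> z \<in> V" "\<And>i. ((\<lambda>z. \<gamma> z $ i) has_field_derivative w $ i) (at 0)"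
  shows "w \<in> tangent_space V (\<gamma> 0)"
  unfolding tangent_space_def
proof (intro CollectI ballI)
  fix f assume f: "f \<in> vanishing_ideal coords4 V"
  then have "f \<in> polyfun coords4" "(\<lambda>z. f (\<gamma> z)) = (\<lambda>z. 0)" using assms(1) by (auto simp: vanishing_ideal_def)
  with polyfun_chain_rule[of f \<gamma> w] assms(2)
  obtain D where D: "((\<lambda>z. 0) has_field_derivative D) (at 0)"
    "((\<lambda>z. f (\<gamma> 0 + z *s w)) has_field_derivative D) (at 0)" by auto
  have "D = 0" using DERIV_unique[OF D(1) DERIV_const] .
  then show "deriv (\<lambda>z. f (\<gamma> 0 + z *s w)) 0 = 0" using D(2) DERIV_imp_deriv by blast
qed

lemma tangent_space_self:
  assumes "is_cone V" "p \<in> V" shows "p \<in> tangent_space V p"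
proof -
  have "p \<in> tangent_space V ((\<lambda>z. (1 + z) *s p) 0)"
  proof (rule tangent_space_curve)
    show "(1 + z) *s p \<in> V" for z using assms unfolding is_cone_def by blast
  qed (auto intro!: derivative_eq_intros)
  then show ?thesis by simp
qed

text \<open>The vanishing ideal of a cone is stable under rescaling the argument. This lets one
  representative of a projective point decide smoothness at all of them.\<close>

lemma tangent_space_scale_subset:
  assumes V: "is_cone V" and c: "c \<noteq> 0"
  shows "tangent_space V (c *s p) \<subseteq> tangent_space V p"
proof
  fix v assume v: "v \<in> tangent_space V (c *s p)"
  show "v \<in> tangent_space V p" unfolding tangent_space_def
  proof (intro CollectI ballI)
    fix f assume f: "f \<in> vanishing_ideal coords4 V"
    define g where "g = (\<lambda>x. f (inverse c *s x))"
    have g: "g \<in> vanishing_ideal coords4 V"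
      using f V by (auto simp: g_def vanishing_ideal_def is_cone_def polyfun_scale)
    have "(\<lambda>z. f (p + z *s v)) = (\<lambda>z. g (c *s p + (c * z) *s v))"
      using c by (simp add: g_def vec_eq_iff fun_eq_iff vector_add_ldistrib vector_smult_assoc
          vector_smult_lid mult.assoc[symmetric])
    moreover have "((\<lambda>z. g (c *s p + z *s v)) has_field_derivative 0) (at 0)"
    proof -
      obtain D where D: "((\<lambda>z. g (c *s p + z *s v)) has_field_derivative D) (at 0)"
        using polyfun_chain_rule[of g "\<lambda>z. c *s p + z *s v" v] g
        by (force simp: vanishing_ideal_def intro!: derivative_eq_intros)
      moreover have "D = 0" using v g D DERIV_imp_deriv unfolding tangent_space_def by blast
      ultimately show ?thesis by simp
    qed
    then have "((\<lambda>z. g (c *s p + (c * z) *s v)) has_field_derivative 0 * c) (at 0)"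
      using DERIV_chain2[of "\<lambda>z. g (c *s p + z *s v)" 0 "\<lambda>z. c * z" 0 c UNIV]
      by (auto intro!: derivative_eq_intros)
    ultimately show "deriv (\<lambda>z. f (p + z *s v)) 0 = 0" by (simp add: DERIV_imp_deriv)
  qed
qed

lemma tangent_space_scale:
  assumes "is_cone V" "c \<noteq> 0"
  shows "tangent_space V (c *s p) = tangent_space V p"
  using tangent_space_scale_subset[OF assms, of p]
    tangent_space_scale_subset[OF assms(1), of "inverse c" "c *s p"] assms(2)
  by (simp add: vector_smult_assoc)

text \<open>A common degree in all four coordinates makes the image a cone; \<open>d > 0\<close>
  sends the origin to 0 and allows \<open>d\<close>-th roots of scalars.\<close>

definition real_form_map :: "(complex \<times> complex \<Rightarrow> complex^4) \<Rightarrow> bool" where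
  "real_form_map \<phi> \<longleftrightarrow> polymap \<phi> \<and> (\<exists>d>0. \<forall>c s t. \<phi> (c * s, c * t) = c ^ d *s \<phi> (s, t)) \<and>
     (\<forall>s\<in>\<real>. \<forall>t\<in>\<real>. \<forall>i. \<phi> (s, t) $ i \<in> \<real>)"

text \<open>In a cone the point is itself a tangent direction, so only the velocity \<open>w\<close>
  in \<open>t\<close> is recorded. The last clause is the upper bound on the tangent space.\<close>

definition smooth_witness :: "(complex^4) set \<Rightarrow> (complex \<times> complex \<Rightarrow> complex^4) \<Rightarrow> bool" where
  "smooth_witness V \<phi> \<longleftrightarrow> (\<exists>s\<in>\<real>. \<exists>t\<in>\<real>. \<exists>w. \<phi> (s, t) \<noteq> 0 \<and> (\<forall>c. w \<noteq> c *s \<phi> (s, t)) \<and>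
     (\<forall>i. ((\<lambda>z. \<phi> (s, t + z) $ i) has_field_derivative w $ i) (at 0)) \<and>
     (\<forall>v\<in>tangent_space V (\<phi> (s, t)). \<exists>x y. v = x *s \<phi> (s, t) + y *s w))"

text \<open>Covering is asked only up to a scalar, which spares extracting roots in each example;
  \<open>real_form_map_scale\<close> absorbs the scalar later.\<close>

definition real_rational_cone :: "(complex^4) set \<Rightarrow> bool" where
  "real_rational_cone V \<longleftrightarrow> (\<exists>\<Phi>. finite \<Phi> \<and>
     (\<forall>\<phi>\<in>\<Phi>. real_form_map \<phi> \<and> range \<phi> \<subseteq> V \<and> smooth_witness V \<phi>) \<and>
     (\<forall>p\<in>V. p \<noteq> 0 \<longrightarrow> (\<exists>\<phi>\<in>\<Phi>. \<exists>c s t. p = c *s \<phi> (s, t))))"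

lemma real_form_map_zero: "real_form_map \<phi> \<Longrightarrow> \<phi> (0, 0) = 0"
  unfolding real_form_map_def by (metis mult_zero_left vector_smult_lzero zero_power)

text \<open>A \<open>d\<close>-th root of \<open>c\<close>, obtained from the complex logarithm, is
  absorbed into both parameters.\<close>

lemma real_form_map_scale:
  assumes "real_form_map \<phi>" shows "c *s \<phi> (s, t) \<in> range \<phi>"
proof (cases "c = 0")
  case True
  then show ?thesis using real_form_map_zero[OF assms] by (metis rangeI vector_smult_lzero)
next
  case False
  obtain d where d: "d > 0" "\<And>c s t. \<phi> (c * s, c * t) = c ^ d *s \<phi> (s, t)"
    using assms by (auto simp: real_form_map_def)
  have "exp (Ln c / of_nat d) ^ d = exp (of_nat d * (Ln c / of_nat d))"
    by (rule exp_of_nat_mult[symmetric])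
  also have "\<dots> = c" using d False by simp
  finally have "c *s \<phi> (s, t) = \<phi> (exp (Ln c / of_nat d) * s, exp (Ln c / of_nat d) * t)"
    using d(2) by simp
  then show ?thesis by simp
qed

lemma is_cone_zhull:
  assumes "is_cone S" shows "is_cone (zhull coords4 S)"
  unfolding is_cone_def
proof (intro conjI ballI allI)
  show "0 \<in> zhull coords4 S" using assms subset_zhull[of S coords4] by (auto simp: is_cone_def)
next
  fix p c assume p: "p \<in> zhull coords4 S"
  show "c *s p \<in> zhull coords4 S" unfolding zhull_def
  proof (intro CollectI ballI)
    fix f assume "f \<in> vanishing_ideal coords4 S"
    then have "(\<lambda>p. f (c *s p)) \<in> vanishing_ideal coords4 S"
      using assms by (auto simp: vanishing_ideal_def polyfun_scale is_cone_def)
    then show "f (c *s p) = 0" using p by (auto simp: zhull_def)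
  qed
qed

lemma is_cone_range:
  assumes "real_form_map \<phi>" shows "is_cone (range \<phi>)"
  unfolding is_cone_def using real_form_map_scale[OF assms] real_form_map_zero[OF assms]
  by (metis imageE prod.collapse rangeI)

section \<open>Local dimension of a parametrized cone\<close>

lemma zclosed_point: "zclosed coords4 {q}"
proof -
  have "{q} = {x. \<forall>f\<in>range (\<lambda>i p. p $ i - q $ i). f x = 0}" by (auto simp: vec_eq_iff)
  moreover have "range (\<lambda>i p. p $ i - q $ i) \<subseteq> polyfun coords4"
    by (auto intro!: polyfun_intros polyfun_coords4)
  ultimately show ?thesis unfolding zclosed_def by blast
qed

lemma zclosed_line: "zclosed coords4 (range (\<lambda>c. c *s q))"
proof (cases "q = 0")
  case True
  then show ?thesis using zclosed_point[of 0] by (simp add: image_constant_conv)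
next
  case False
  then obtain j where j: "q $ j \<noteq> 0" by (auto simp: vec_eq_iff)
  have "range (\<lambda>c. c *s q) = {x. \<forall>f\<in>range (\<lambda>i p. q $ j * p $ i - q $ i * p $ j). f x = 0}"
  proof (intro set_eqI iffI)
    fix x assume "x \<in> {x. \<forall>f\<in>range (\<lambda>i p. q $ j * p $ i - q $ i * p $ j). f x = 0}"
    then have "q $ j * x $ i = q $ i * x $ j" for i by auto
    then have "x = (x $ j / q $ j) *s q" using j by (auto simp: vec_eq_iff field_simps)
    then show "x \<in> range (\<lambda>c. c *s q)" by blast
  qed auto
  moreover have "range (\<lambda>i p. q $ j * p $ i - q $ i * p $ j) \<subseteq> polyfun coords4"
    by (auto intro!: polyfun_intros polyfun_coords4)
  ultimately show ?thesis unfolding zclosed_def by blast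
qed

text \<open>The chain formed by the point, the line joining it to the vertex, and the closure of the
  image gives the lower bound. For the upper bound, irreducibility puts the fourth member of a
  longer chain inside the closure of a single image, where \<open>no_chain_of_length_3\<close>
  applies.\<close>

lemma local_dim_eq_2:
  assumes \<Phi>: "finite \<Phi>" "\<And>\<phi>. \<phi> \<in> \<Phi> \<Longrightarrow> polymap \<phi>" "V \<subseteq> (\<Union>\<phi>\<in>\<Phi>. zhull coords4 (range \<phi>))"
    and \<phi>: "polymap \<phi>" "zhull coords4 (range \<phi>) \<subseteq> V"
    and q: "q \<noteq> 0" "range (\<lambda>c. c *s q) \<subset> zhull coords4 (range \<phi>)"
  shows "local_dim coords4 V q = 2"
proof -
  define N where "N = {n. \<exists>Y :: nat \<Rightarrow> (complex^4) set.
      (\<forall>i\<le>n. Y i \<subseteq> V \<and> zclosed coords4 (Y i) \<and> zirred coords4 (Y i)) \<and>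
      (\<forall>i<n. Y i \<subset> Y (Suc i)) \<and> q \<in> Y 0}"
  have "n \<le> 2" if "n \<in> N" for n
  proof (rule ccontr)
    assume "\<not> n \<le> 2"
    obtain Y where Y: "\<And>i. i \<le> n \<Longrightarrow> Y i \<subseteq> V \<and> zclosed coords4 (Y i) \<and> zirred coords4 (Y i)"
      "\<And>i. i < n \<Longrightarrow> Y i \<subset> Y (Suc i)" "q \<in> Y 0" using \<open>n \<in> N\<close> by (auto simp: N_def)
    have "Y 0 \<subset> Y 1" "Y 1 \<subset> Y 2" "Y 2 \<subset> Y 3"
      using Y(2)[of 0] Y(2)[of 1] Y(2)[of 2] \<open>\<not> n \<le> 2\<close> by (auto simp: numeral_eq_Suc)
    moreover have "\<exists>\<psi>\<in>\<Phi>. Y 3 \<subseteq> zhull coords4 (range \<psi>)"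
      by (rule zirred_finite_cover[OF \<Phi>(1)]) (use Y(1)[of 3] \<open>\<not> n \<le> 2\<close> \<Phi>(3) in \<open>auto simp: zclosed_zhull\<close>)
    then obtain \<psi> where "\<psi> \<in> \<Phi>" "Y 3 \<subseteq> zhull coords4 (range \<psi>)" by blast
    ultimately show False
      using no_chain_of_length_3[of "Y 0" "Y 1" "Y 2" "Y 3" \<psi>] Y(1)[of 0] Y(1)[of 1] Y(1)[of 2]
        Y(1)[of 3] Y(3) \<open>\<not> n \<le> 2\<close> \<Phi>(2) by auto
  qed
  moreover have "2 \<in> N"
  proof -
    define Y where "Y = (\<lambda>n::nat. if n = 0 then {q} else if n = 1 then range (\<lambda>c. c *s q)
      else zhull coords4 (range \<phi>))"
    have pt: "zirred coords4 {q}"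
      using zirred_range_polymap[of "\<lambda>_. q"] by (simp add: polymap_def image_constant_conv polyfun.const)
    have "range (\<lambda>x :: complex \<times> complex. fst x *s q) = range (\<lambda>c. c *s q)" by (auto simp: image_iff)
    moreover have "polymap (\<lambda>x. fst x *s q)" by (auto simp: polymap_def intro!: polyfun_intros polyfun_fst)
    ultimately have line: "zirred coords4 (range (\<lambda>c. c *s q))" using zirred_range_polymap by metis
    have qline: "q \<in> range (\<lambda>c. c *s q)" "0 \<in> range (\<lambda>c. c *s q)"
      by (metis rangeI vector_smult_lid) (metis rangeI vector_smult_lzero)
    have "\<forall>i\<le>2. Y i \<subseteq> V \<and> zclosed coords4 (Y i) \<and> zirred coords4 (Y i)"
      using pt line zclosed_point zclosed_line zclosed_zhull zirred_zhull[OF zirred_range_polymap[OF \<phi>(1)]]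
        \<phi>(2) q(2) qline(1) unfolding Y_def by auto
    moreover have "Y i \<subset> Y (Suc i)" if "i < 2" for i
    proof -
      consider "i = 0" | "i = 1" using \<open>i < 2\<close> by linarith
      then show ?thesis using q qline by cases (auto simp: Y_def)
    qed
    moreover have "q \<in> Y 0" by (simp add: Y_def)
    ultimately show ?thesis unfolding N_def by blast
  qed
  ultimately have "Sup N = 2" by (intro cSup_eq_maximum) auto
  then show ?thesis unfolding local_dim_def N_def .
qed

section \<open>Projective components and real points\<close>

lemma mem_proj_class_self: "p \<in> proj_class p"
  unfolding proj_class_def by (rule CollectI, rule exI[of _ 1]) simp

lemma proj_class_scale: "c \<noteq> 0 \<Longrightarrow> proj_class (c *s p) = proj_class p"
proof -
  assume c: "c \<noteq> 0"
  have "\<exists>c'. b *s p = c' *s (c *s p) \<and> c' \<noteq> 0" if "b \<noteq> 0" for b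
    using c that by (intro exI[of _ "b / c"]) (simp add: vector_smult_assoc)
  moreover have "\<exists>c'. b *s (c *s p) = c' *s p \<and> c' \<noteq> 0" if "b \<noteq> 0" for b
    using c that by (intro exI[of _ "b * c"]) (simp add: vector_smult_assoc)
  ultimately show ?thesis unfolding proj_class_def by blast
qed

lemma mem_proj_class_eq: "q \<in> proj_class p \<Longrightarrow> proj_class q = proj_class p"
proof -
  assume "q \<in> proj_class p"
  then obtain c where "c \<noteq> 0" "q = c *s p" by (auto simp: proj_class_def)
  then show ?thesis by (simp add: proj_class_scale)
qed

definition projectivize :: "(complex^4) set \<Rightarrow> (complex^4) set set" where
  "projectivize V = {proj_class p | p. p \<noteq> 0 \<and> p \<in> V}"

lemma cone_projectivize:
  assumes "is_cone V" shows "insert 0 (\<Union>(projectivize V)) = V"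
proof (intro subset_antisym subsetI)
  fix p assume "p \<in> V"
  then show "p \<in> insert 0 (\<Union>(projectivize V))"
    using mem_proj_class_self by (cases "p = 0") (auto simp: projectivize_def)
next
  fix p assume "p \<in> insert 0 (\<Union>(projectivize V))"
  then show "p \<in> V" using assms by (auto simp: projectivize_def proj_class_def is_cone_def)
qed

text \<open>A nonzero vector lies in one class only, so membership can be read off the affine
  cone.\<close>

lemma proj_class_in_iff:
  assumes "X \<subseteq> P3" "p \<noteq> 0" shows "proj_class p \<in> X \<longleftrightarrow> p \<in> insert 0 (\<Union>X)"
proof
  assume "p \<in> insert 0 (\<Union>X)"
  then obtain x where x: "x \<in> X" "p \<in> x" using assms(2) by auto
  then obtain q where "x = proj_class q" using assms(1) by (auto simp: P3_def)
  then show "proj_class p \<in> X" using x mem_proj_class_eq by metis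
qed (use mem_proj_class_self in blast)

lemma projectivize_subset_P3: "projectivize V \<subseteq> P3"
  by (auto simp: projectivize_def P3_def)

lemma projectivize_subset_iff:
  assumes "is_cone V" "X \<subseteq> P3" shows "projectivize V \<subseteq> X \<longleftrightarrow> V \<subseteq> insert 0 (\<Union>X)"
proof
  assume "projectivize V \<subseteq> X"
  then show "V \<subseteq> insert 0 (\<Union>X)" using cone_projectivize[OF assms(1)] by blast
next
  assume "V \<subseteq> insert 0 (\<Union>X)"
  then show "projectivize V \<subseteq> X" unfolding projectivize_def
    using proj_class_in_iff[OF assms(2)] by blast
qed

lemma pclosed_projectivize: "is_cone V \<Longrightarrow> zclosed coords4 V \<Longrightarrow> pclosed (projectivize V)"
  by (simp add: pclosed_def projectivize_subset_P3 cone_projectivize)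

lemma pirred_projectivize:
  assumes "is_cone V" "zirred coords4 V" "p \<in> V" "p \<noteq> 0"
  shows "pirred (projectivize V)"
  unfolding pirred_def
proof (intro conjI allI impI)
  show "projectivize V \<noteq> {}" using assms by (auto simp: projectivize_def)
next
  fix X1 X2 assume X: "pclosed X1 \<and> pclosed X2 \<and> projectivize V \<subseteq> X1 \<union> X2"
  then have P: "X1 \<subseteq> P3" "X2 \<subseteq> P3" by (auto simp: pclosed_def)
  then have "X1 \<union> X2 \<subseteq> P3" by simp
  from projectivize_subset_iff[OF assms(1) this] X
  have "V \<subseteq> insert 0 (\<Union>X1) \<union> insert 0 (\<Union>X2)" by auto
  moreover have "zclosed coords4 (insert 0 (\<Union>X1))" "zclosed coords4 (insert 0 (\<Union>X2))"
    using X by (auto simp: pclosed_def)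
  ultimately have "V \<subseteq> insert 0 (\<Union>X1) \<or> V \<subseteq> insert 0 (\<Union>X2)"
    using assms(2) unfolding zirred_def by blast
  then show "projectivize V \<subseteq> X1 \<or> projectivize V \<subseteq> X2"
    using projectivize_subset_iff[OF assms(1)] P by blast
qed

lemma pclosed_Un: "pclosed X \<Longrightarrow> pclosed Y \<Longrightarrow> pclosed (X \<union> Y)"
  using zclosed_Un[of coords4 "insert 0 (\<Union>X)" "insert 0 (\<Union>Y)"] by (simp add: pclosed_def)

lemma pirred_finite_cover:
  assumes "finite I" "pirred Y" "\<And>i. i \<in> I \<Longrightarrow> pclosed (Z i)" "Y \<subseteq> (\<Union>i\<in>I. Z i)"
  shows "\<exists>i\<in>I. Y \<subseteq> Z i"
  using assms(1,3,4)
proof (induction I)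
  case empty
  then show ?case using assms(2) by (auto simp: pirred_def)
next
  case (insert i I)
  have "pclosed (\<Union>i\<in>I. Z i)" using \<open>finite I\<close> insert.prems(1)
  proof (induction I)
    case empty
    then show ?case using zclosed_point[of 0] by (simp add: pclosed_def)
  qed (auto intro: pclosed_Un)
  then have "Y \<subseteq> Z i \<or> Y \<subseteq> (\<Union>i\<in>I. Z i)"
    using assms(2) insert.prems unfolding pirred_def by (metis UN_insert insertI1)
  then show ?case using insert by auto
qed

lemma real_rational_coneE:
  assumes "real_rational_cone V"
  obtains \<Phi> where "finite \<Phi>" "\<And>\<phi>. \<phi> \<in> \<Phi> \<Longrightarrow> real_form_map \<phi> \<and> range \<phi> \<subseteq> V \<and> smooth_witness V \<phi>"
    "\<And>p. p \<in> V \<Longrightarrow> p \<noteq> 0 \<Longrightarrow> \<exists>\<phi>\<in>\<Phi>. \<exists>c s t. p = c *s \<phi> (s, t)"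
proof -
  obtain \<Phi> where "finite \<Phi>" and 1: "\<forall>\<phi>\<in>\<Phi>. real_form_map \<phi> \<and> range \<phi> \<subseteq> V \<and> smooth_witness V \<phi>"
    and 2: "\<forall>p\<in>V. p \<noteq> 0 \<longrightarrow> (\<exists>\<phi>\<in>\<Phi>. \<exists>c s t. p = c *s \<phi> (s, t))"
    using assms unfolding real_rational_cone_def by (elim exE conjE)
  then show thesis by (intro that[of \<Phi>] 1[rule_format] 2[rule_format])
qed

text \<open>Point and velocity form a basis of the tangent space, and the local dimension is two as
  well. All nonzero multiples are included because \<open>psmooth\<close> asks for smoothness at
  every representative.\<close>

lemma smooth_witness_smooth:
  assumes V: "is_cone V" "zclosed coords4 V"
    and \<Phi>: "finite \<Phi>" "\<And>\<phi>. \<phi> \<in> \<Phi> \<Longrightarrow> polymap \<phi>" "V \<subseteq> (\<Union>\<phi>\<in>\<Phi>. zhull coords4 (range \<phi>))"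
    and \<phi>: "real_form_map \<phi>" "range \<phi> \<subseteq> V" "smooth_witness V \<phi>"
  shows "\<exists>s\<in>\<real>. \<exists>t\<in>\<real>. \<phi> (s, t) \<noteq> 0 \<and> (\<forall>c. c \<noteq> 0 \<longrightarrow> smooth_at4 V (c *s \<phi> (s, t)))"
proof -
  obtain s t w where st: "s \<in> \<real>" "t \<in> \<real>" and nz: "\<phi> (s, t) \<noteq> 0" and ind: "\<And>c. w \<noteq> c *s \<phi> (s, t)"
    and der: "\<And>i. ((\<lambda>z. \<phi> (s, t + z) $ i) has_field_derivative w $ i) (at 0)"
    and span: "\<And>v. v \<in> tangent_space V (\<phi> (s, t)) \<Longrightarrow> \<exists>x y. v = x *s \<phi> (s, t) + y *s w"
    using \<phi>(3) unfolding smooth_witness_def by blast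
  define p where "p = \<phi> (s, t)"
  have pV: "p \<in> V" using \<phi>(2) by (auto simp: p_def)
  have "vec.dim (tangent_space V p) = 2"
  proof (rule vec.dim_unique)
    show "{p, w} \<subseteq> tangent_space V p"
      using tangent_space_self[OF V(1) pV] tangent_space_curve[of "\<lambda>z. \<phi> (s, t + z)" V w] \<phi>(2) der
      by (auto simp: p_def)
    show "tangent_space V p \<subseteq> vec.span {p, w}"
    proof
      fix v assume "v \<in> tangent_space V p"
      then obtain x y where "v = x *s p + y *s w" using span[folded p_def] by blast
      then show "v \<in> vec.span {p, w}"
        by (simp add: vec.span_add vec.span_scale vec.span_base)
    qed
    have "w \<notin> vec.span {p}" using ind by (auto simp: vec.span_singleton p_def)
    then show "vec.independent {p, w}" using nz
      by (subst insert_commute) (auto simp: vec.independent_insert p_def)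
    show "card {p, w} = 2" using ind[of 1] by (auto simp: p_def)
  qed
  moreover have "local_dim coords4 V (c *s p) = 2" if c: "c \<noteq> 0" for c
  proof (rule local_dim_eq_2[OF \<Phi>])
    show "polymap \<phi>" using \<phi>(1) by (simp add: real_form_map_def)
    show "zhull coords4 (range \<phi>) \<subseteq> V" using zhull_minimal[OF V(2) \<phi>(2)] .
    show "c *s p \<noteq> 0" using c nz by (simp add: p_def)
    have "range \<phi> \<subseteq> zhull coords4 (range \<phi>)" by (rule subset_zhull)
    moreover have "b *s (c *s p) \<in> range \<phi>" for b
      using real_form_map_scale[OF \<phi>(1), of "b * c" s t] by (simp add: p_def vector_smult_assoc)
    \<comment> \<open>If the image stayed on the line through \<open>p\<close>, every minor of
      \<open>p\<close> and \<open>\<phi> (s, t + z)\<close> would vanish identically in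
      \<open>z\<close>; differentiating at 0 would make \<open>w\<close> a multiple of
      \<open>p\<close>.\<close>
    moreover have "\<not> range \<phi> \<subseteq> range (\<lambda>b. b *s (c *s p))"
    proof
      assume "range \<phi> \<subseteq> range (\<lambda>b. b *s (c *s p))"
      then have "\<exists>b. \<phi> x = b *s p" for x by (force simp: vector_smult_assoc)
      then obtain k where k: "\<And>x. \<phi> x = k x *s p" by metis
      obtain j where j: "p $ j \<noteq> 0" using nz by (auto simp: p_def vec_eq_iff)
      have "p $ j * w $ i = p $ i * w $ j" for i
      proof -
        have "((\<lambda>z. p $ j * \<phi> (s, t + z) $ i - p $ i * \<phi> (s, t + z) $ j) has_field_derivative
            p $ j * w $ i - p $ i * w $ j) (at 0)"
          using der by (intro DERIV_diff DERIV_cmult)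
        moreover have "(\<lambda>z. p $ j * \<phi> (s, t + z) $ i - p $ i * \<phi> (s, t + z) $ j) = (\<lambda>z. 0)"
          by (simp add: k fun_eq_iff)
        ultimately show ?thesis using DERIV_unique[OF _ DERIV_const] by fastforce
      qed
      then have "w = (w $ j / p $ j) *s p" using j by (simp add: vec_eq_iff field_simps)
      then show False using ind by (auto simp: p_def)
    qed
    ultimately show "range (\<lambda>b. b *s (c *s p)) \<subset> zhull coords4 (range \<phi>)" by blast
  qed
  ultimately have "smooth_at4 V (c *s p)" if "c \<noteq> 0" for c
    using that tangent_space_scale[OF V(1) that] pV V(1) by (simp add: smooth_at4_def is_cone_def)
  then show ?thesis using st nz by (auto simp: p_def)
qed

lemma real_form_map_real_ppoint:
  "real_form_map \<phi> \<Longrightarrow> s \<in> \<real> \<Longrightarrow> t \<in> \<real> \<Longrightarrow> real_ppoint (proj_class (\<phi> (s, t)))"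
  unfolding real_ppoint_def real_form_map_def
  by (intro bexI[of _ "\<phi> (s, t)"] mem_proj_class_self) simp

text \<open>A component lies in one of the closed images by irreducibility and equals it by
  maximality, so it contains the real smooth point of that image. For density, the equations of a
  closed set containing the real points pull back to functions that vanish on the real
  plane.\<close>

theorem real_rational_cone_components:
  assumes V: "is_cone V" "zclosed coords4 V" "real_rational_cone V"
  shows "(\<forall>Y. pcomponent (projectivize V) Y \<longrightarrow> (\<exists>x\<in>Y. real_ppoint x \<and> psmooth (projectivize V) x)) \<and>
    pclosure {x \<in> projectivize V. real_ppoint x} = projectivize V"
proof (intro conjI allI impI)
  obtain \<Phi> where \<Phi>: "finite \<Phi>" "\<And>\<phi>. \<phi> \<in> \<Phi> \<Longrightarrow> real_form_map \<phi> \<and> range \<phi> \<subseteq> V \<and> smooth_witness V \<phi>"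
    and cover: "\<And>p. p \<in> V \<Longrightarrow> p \<noteq> 0 \<Longrightarrow> \<exists>\<phi>\<in>\<Phi>. \<exists>c s t. p = c *s \<phi> (s, t)"
    by (rule real_rational_coneE[OF V(3)]) (rule that)
  have cover': "\<exists>\<phi>\<in>\<Phi>. p \<in> range \<phi>" if "p \<in> V" "p \<noteq> 0" for p
    using cover[OF that] real_form_map_scale \<Phi>(2) by blast
  let ?H = "\<lambda>\<phi>. zhull coords4 (range \<phi>)"
  have cover_H: "\<exists>\<phi>\<in>\<Phi>. p \<in> ?H \<phi>" if "p \<in> V" "p \<noteq> 0" for p
    using cover'[OF that] by (meson subset_zhull subsetD)
  have H: "is_cone (?H \<phi>)" "?H \<phi> \<subseteq> V" "polymap \<phi>" if "\<phi> \<in> \<Phi>" for \<phi>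
    using is_cone_zhull is_cone_range zhull_minimal[OF V(2)] \<Phi>(2)[OF that]
    by (auto simp: real_form_map_def)
  have proj_H: "projectivize (?H \<phi>) \<subseteq> projectivize V" if "\<phi> \<in> \<Phi>" for \<phi>
    using H(2)[OF that] by (auto simp: projectivize_def)
  {
    fix Y assume Y: "pcomponent (projectivize V) Y"
    have "projectivize V \<subseteq> (\<Union>\<phi>\<in>\<Phi>. projectivize (?H \<phi>))"
    proof
      fix x assume "x \<in> projectivize V"
      then obtain p where p: "x = proj_class p" "p \<noteq> 0" "p \<in> V" by (auto simp: projectivize_def)
      then obtain \<phi> where "\<phi> \<in> \<Phi>" "p \<in> ?H \<phi>" using cover_H by metis
      moreover from this have "x \<in> projectivize (?H \<phi>)" using p unfolding projectivize_def by blast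
      ultimately show "x \<in> (\<Union>\<phi>\<in>\<Phi>. projectivize (?H \<phi>))" by auto
    qed
    then have "Y \<subseteq> (\<Union>\<phi>\<in>\<Phi>. projectivize (?H \<phi>))"
      using Y unfolding pcomponent_def by (elim conjE) (rule order_trans)
    moreover have "pclosed (projectivize (?H \<phi>))" if "\<phi> \<in> \<Phi>" for \<phi>
      using pclosed_projectivize H(1)[OF that] zclosed_zhull by blast
    ultimately obtain \<phi> where \<phi>: "\<phi> \<in> \<Phi>" "Y \<subseteq> projectivize (?H \<phi>)" "pclosed (projectivize (?H \<phi>))"
      using pirred_finite_cover[OF \<Phi>(1), of Y "\<lambda>\<phi>. projectivize (?H \<phi>)"] Y by (auto simp: pcomponent_def)
    have 0: "0 \<in> ?H \<phi>" using H(1)[OF \<phi>(1)] by (simp add: is_cone_def)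
    show "\<exists>x\<in>Y. real_ppoint x \<and> psmooth (projectivize V) x"
    proof -
      have "V \<subseteq> (\<Union>\<phi>\<in>\<Phi>. ?H \<phi>)"
      proof
        fix p assume "p \<in> V"
        then show "p \<in> (\<Union>\<phi>\<in>\<Phi>. ?H \<phi>)"
          using cover_H[of p] 0 \<phi>(1) by (cases "p = 0") auto
      qed
      then obtain s t where st: "s \<in> \<real>" "t \<in> \<real>" "\<phi> (s, t) \<noteq> 0"
        and sm: "\<And>c. c \<noteq> 0 \<Longrightarrow> smooth_at4 V (c *s \<phi> (s, t))"
        using smooth_witness_smooth[OF V(1,2) \<Phi>(1) H(3), of \<phi>] \<Phi>(2)[OF \<phi>(1)] by blast
      have in_H: "\<phi> (s, t) \<in> ?H \<phi>" using subset_zhull[of "range \<phi>" coords4] by blast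
      have "pirred (projectivize (?H \<phi>))"
        using pirred_projectivize[OF H(1)[OF \<phi>(1)] zirred_zhull[OF zirred_range_polymap[OF H(3)[OF \<phi>(1)]]] in_H st(3)] .
      then have "Y = projectivize (?H \<phi>)"
        using Y \<phi> proj_H[OF \<phi>(1)] unfolding pcomponent_def by blast
      then have Yin: "proj_class (\<phi> (s, t)) \<in> Y" using in_H st(3) by (auto simp: projectivize_def)
      have "real_ppoint (proj_class (\<phi> (s, t)))"
        using \<Phi>(2)[OF \<phi>(1)] st by (intro real_form_map_real_ppoint) auto
      moreover have "psmooth (projectivize V) (proj_class (\<phi> (s, t)))"
        unfolding psmooth_def cone_projectivize[OF V(1)]
        using Yin Y sm by (auto simp: proj_class_def pcomponent_def)
      ultimately show ?thesis using Yin by blast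
    qed
  }
  show "pclosure {x \<in> projectivize V. real_ppoint x} = projectivize V"
  proof
    show "pclosure {x \<in> projectivize V. real_ppoint x} \<subseteq> projectivize V"
      using pclosed_projectivize[OF V(1,2)] by (auto simp: pclosure_def)
    show "projectivize V \<subseteq> pclosure {x \<in> projectivize V. real_ppoint x}"
      unfolding pclosure_def
    proof (rule Inter_greatest)
      fix X assume "X \<in> {X. pclosed X \<and> {x \<in> projectivize V. real_ppoint x} \<subseteq> X}"
      then have X: "X \<subseteq> P3" "zclosed coords4 (insert 0 (\<Union>X))" "{x \<in> projectivize V. real_ppoint x} \<subseteq> X"
        by (auto simp: pclosed_def)
      obtain F where F: "F \<subseteq> polyfun coords4" "insert 0 (\<Union>X) = {x. \<forall>f\<in>F. f x = 0}"
        using X(2) unfolding zclosed_def by blast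
      have "range \<phi> \<subseteq> insert 0 (\<Union>X)" if \<phi>: "\<phi> \<in> \<Phi>" for \<phi>
      proof -
        have "f (\<phi> x) = 0" if f: "f \<in> F" for f x
        proof (rule polyfun_coords2_real_zero[where f="\<lambda>x. f (\<phi> x)"])
          show "(\<lambda>x. f (\<phi> x)) \<in> polyfun coords2" using polymap_compose H(3)[OF \<phi>] F(1) f by blast
          fix s t :: complex assume st: "s \<in> \<real>" "t \<in> \<real>"
          have "\<phi> (s, t) \<in> insert 0 (\<Union>X)"
          proof (cases "\<phi> (s, t) = 0")
            case False
            have "real_ppoint (proj_class (\<phi> (s, t)))"
              using \<Phi>(2)[OF \<phi>] st by (intro real_form_map_real_ppoint) auto
            moreover have "proj_class (\<phi> (s, t)) \<in> projectivize V"
              using False \<Phi>(2)[OF \<phi>] by (auto simp: projectivize_def)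
            ultimately show ?thesis using X(3) mem_proj_class_self by blast
          qed simp
          then show "f (\<phi> (s, t)) = 0" using F(2) f by blast
        qed
        then show ?thesis unfolding F(2) by blast
      qed
      then have "V \<subseteq> insert 0 (\<Union>X)" using cover' by blast
      then show "projectivize V \<subseteq> X" using projectivize_subset_iff[OF V(1) X(1)] by blast
    qed
  qed
qed

text \<open>A coordinate permutation preserves polynomial functions and real points, so
  parametrizations move forward along \<open>\<sigma>\<close> and tangent vectors move back along
  \<open>\<tau>\<close>.\<close>

lemma real_rational_cone_permute:
  fixes \<pi> \<rho> :: "4 \<Rightarrow> 4"
  assumes V: "real_rational_cone V" and inv: "\<And>i. \<pi> (\<rho> i) = i" "\<And>i. \<rho> (\<pi> i) = i"
  shows "real_rational_cone {p. (\<chi> i. p $ \<pi> i) \<in> V}"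
proof -
  define W where "W = {p. (\<chi> i. p $ \<pi> i) \<in> V}"
  define \<sigma> where "\<sigma> = (\<lambda>p :: complex^4. \<chi> i. p $ \<rho> i)"
  define \<tau> where "\<tau> = (\<lambda>p :: complex^4. \<chi> i. p $ \<pi> i)"
  have \<sigma>\<tau>: "\<sigma> (\<tau> p) = p" "\<tau> (\<sigma> p) = p" for p
    using inv by (auto simp: \<sigma>_def \<tau>_def vec_eq_iff)
  have lin: "\<sigma> (p + q) = \<sigma> p + \<sigma> q" "\<sigma> (c *s p) = c *s \<sigma> p" "\<tau> (p + q) = \<tau> p + \<tau> q" "\<tau> (c *s p) = c *s \<tau> p"
    for p q c by (auto simp: \<sigma>_def \<tau>_def vec_eq_iff)
  have z: "\<sigma> p = 0 \<longleftrightarrow> p = 0" for p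
    using \<sigma>\<tau>(2)[of p] lin(4)[of 0 p] lin(2)[of 0 p] by (metis \<sigma>\<tau> lin(4) vector_smult_lzero)
  have W: "p \<in> W \<longleftrightarrow> \<tau> p \<in> V" for p by (simp add: W_def \<tau>_def)
  obtain \<Phi> where \<Phi>: "finite \<Phi>" "\<And>\<phi>. \<phi> \<in> \<Phi> \<Longrightarrow> real_form_map \<phi> \<and> range \<phi> \<subseteq> V \<and> smooth_witness V \<phi>"
    and cover: "\<And>p. p \<in> V \<Longrightarrow> p \<noteq> 0 \<Longrightarrow> \<exists>\<phi>\<in>\<Phi>. \<exists>c s t. p = c *s \<phi> (s, t)"
    by (rule real_rational_coneE[OF V]) (rule that)
  have tangent: "\<tau> v \<in> tangent_space V p" if v: "v \<in> tangent_space W (\<sigma> p)" for v p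
    unfolding tangent_space_def
  proof (intro CollectI ballI)
    fix f assume f: "f \<in> vanishing_ideal coords4 V"
    then have "(\<lambda>x. f (\<tau> x)) \<in> polyfun coords4"
      using polyfun_compose4[of f \<tau>] by (simp add: vanishing_ideal_def \<tau>_def polyfun_coords4)
    then have "(\<lambda>x. f (\<tau> x)) \<in> vanishing_ideal coords4 W"
      using W f by (simp add: vanishing_ideal_def)
    from v[unfolded tangent_space_def mem_Collect_eq, rule_format, OF this]
    have "deriv (\<lambda>z. f (\<tau> (\<sigma> p + z *s v))) 0 = 0" .
    then show "deriv (\<lambda>z. f (p + z *s \<tau> v)) 0 = 0" by (simp add: lin \<sigma>\<tau>)
  qed
  have "real_form_map (\<lambda>x. \<sigma> (\<phi> x)) \<and> range (\<lambda>x. \<sigma> (\<phi> x)) \<subseteq> W \<and> smooth_witness W (\<lambda>x. \<sigma> (\<phi> x))"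
    if \<phi>: "\<phi> \<in> \<Phi>" for \<phi>
  proof (intro conjI)
    show "real_form_map (\<lambda>x. \<sigma> (\<phi> x))" using \<Phi>(2)[OF \<phi>] lin(2)
      unfolding real_form_map_def polymap_def by (auto simp: \<sigma>_def)
    show "range (\<lambda>x. \<sigma> (\<phi> x)) \<subseteq> W" using \<Phi>(2)[OF \<phi>] by (auto simp: W \<sigma>\<tau>)
    obtain s t w where *: "s \<in> \<real>" "t \<in> \<real>" "\<phi> (s, t) \<noteq> 0" "\<And>c. w \<noteq> c *s \<phi> (s, t)"
      "\<And>i. ((\<lambda>z. \<phi> (s, t + z) $ i) has_field_derivative w $ i) (at 0)"
      "\<And>v. v \<in> tangent_space V (\<phi> (s, t)) \<Longrightarrow> \<exists>x y. v = x *s \<phi> (s, t) + y *s w"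
      using \<Phi>(2)[OF \<phi>] unfolding smooth_witness_def by blast
    have "\<exists>x y. v = x *s \<sigma> (\<phi> (s, t)) + y *s \<sigma> w" if "v \<in> tangent_space W (\<sigma> (\<phi> (s, t)))" for v
      using *(6)[OF tangent[OF that]] by (metis \<sigma>\<tau>(1) lin(1,2))
    moreover have "\<sigma> w \<noteq> c *s \<sigma> (\<phi> (s, t))" for c using *(4)[of c] by (metis \<sigma>\<tau>(2) lin(4))
    moreover have "((\<lambda>z. \<sigma> (\<phi> (s, t + z)) $ i) has_field_derivative \<sigma> w $ i) (at 0)" for i
      using *(5) by (simp add: \<sigma>_def)
    ultimately show "smooth_witness W (\<lambda>x. \<sigma> (\<phi> x))"
      unfolding smooth_witness_def using *(1-3) z by blast
  qed
  moreover have "\<exists>\<phi>\<in>\<Phi>. \<exists>c s t. p = c *s \<sigma> (\<phi> (s, t))" if p: "p \<in> W" "p \<noteq> 0" for p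
  proof -
    have "\<tau> p \<in> V" "\<tau> p \<noteq> 0" using p W z[of "\<tau> p"] \<sigma>\<tau>(1)[of p] by auto
    then show ?thesis using cover by (metis \<sigma>\<tau>(1) lin(2))
  qed
  ultimately show ?thesis unfolding real_rational_cone_def W_def[symmetric] using \<Phi>(1)
    by (intro exI[of _ "(\<lambda>\<phi> x. \<sigma> (\<phi> x)) ` \<Phi>"]) auto
qed

section \<open>Cones over pairs of quadrics\<close>

definition vec4 :: "'a \<Rightarrow> 'a \<Rightarrow> 'a \<Rightarrow> 'a \<Rightarrow> 'a^4" where
  "vec4 x y z w = (\<chi> i. if i = 1 then x else if i = 2 then y else if i = 3 then z else w)"

lemma vec4_nth [simp]:
  "vec4 x y z w $ 1 = x" "vec4 x y z w $ 2 = y" "vec4 x y z w $ 3 = z" "vec4 x y z w $ 4 = w"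
  by (simp_all add: vec4_def)

lemma vec4_eq_iff: "p = (q :: 'a^4) \<longleftrightarrow> p $ 1 = q $ 1 \<and> p $ 2 = q $ 2 \<and> p $ 3 = q $ 3 \<and> p $ 4 = q $ 4"
  by (simp add: vec_eq_iff forall_4)

text \<open>The coefficients are free parameters, since after a coordinate permutation they need no
  longer be differences of payoffs.\<close>

definition quad1 :: "complex \<Rightarrow> complex \<Rightarrow> complex \<Rightarrow> complex \<Rightarrow> complex^4 \<Rightarrow> complex" where
  "quad1 a b c d p = a * p$1 * p$3 + b * p$1 * p$4 + c * p$2 * p$3 + d * p$2 * p$4"

definition quad2 :: "complex \<Rightarrow> complex \<Rightarrow> complex \<Rightarrow> complex \<Rightarrow> complex^4 \<Rightarrow> complex" where
  "quad2 e f g h p = e * p$1 * p$2 + f * p$1 * p$4 + g * p$2 * p$3 + h * p$3 * p$4"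

definition quad_cone :: "complex \<Rightarrow> complex \<Rightarrow> complex \<Rightarrow> complex \<Rightarrow> complex \<Rightarrow> complex \<Rightarrow> complex \<Rightarrow> complex
    \<Rightarrow> (complex^4) set" where
  "quad_cone a b c d e f g h = {p. quad1 a b c d p = 0 \<and> quad2 e f g h p = 0}"

lemma polyfun_quad1: "quad1 a b c d \<in> polyfun coords4"
  unfolding quad1_def[abs_def] by (intro polyfun_intros polyfun_coords4)

lemma polyfun_quad2: "quad2 e f g h \<in> polyfun coords4"
  unfolding quad2_def[abs_def] by (intro polyfun_intros polyfun_coords4)

lemma zclosed_quad_cone: "zclosed coords4 (quad_cone a b c d e f g h)"
  unfolding quad_cone_def Collect_conj_eq
  by (intro zclosed_Int zclosed_zero_set polyfun_quad1 polyfun_quad2)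

lemma quad_scale: "quad1 a b c d (x *s p) = x * x * quad1 a b c d p"
  "quad2 e f g h (x *s p) = x * x * quad2 e f g h p"
  by (simp_all add: quad1_def quad2_def algebra_simps)

lemma is_cone_quad_cone: "is_cone (quad_cone a b c d e f g h)"
  unfolding is_cone_def quad_cone_def by (auto simp: quad_scale) (auto simp: quad1_def quad2_def)

lemma tangent_space_quad_cone:
  assumes "v \<in> tangent_space (quad_cone a b c d e f g h) p"
  shows "a * (p$1 * v$3 + v$1 * p$3) + b * (p$1 * v$4 + v$1 * p$4) + c * (p$2 * v$3 + v$2 * p$3)
      + d * (p$2 * v$4 + v$2 * p$4) = 0"
    and "e * (p$1 * v$2 + v$1 * p$2) + f * (p$1 * v$4 + v$1 * p$4) + g * (p$2 * v$3 + v$2 * p$3)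
      + h * (p$3 * v$4 + v$3 * p$4) = 0"
proof -
  have 1: "quad1 a b c d \<in> vanishing_ideal coords4 (quad_cone a b c d e f g h)"
    and 2: "quad2 e f g h \<in> vanishing_ideal coords4 (quad_cone a b c d e f g h)"
    by (auto simp: vanishing_ideal_def polyfun_quad1 polyfun_quad2 quad_cone_def)
  have "((\<lambda>z. quad1 a b c d (p + z *s v)) has_field_derivative
     (a * (p$1 * v$3 + v$1 * p$3) + b * (p$1 * v$4 + v$1 * p$4) + c * (p$2 * v$3 + v$2 * p$3)
      + d * (p$2 * v$4 + v$2 * p$4))) (at 0)"
    unfolding quad1_def by (auto intro!: derivative_eq_intros simp: algebra_simps)
  from DERIV_imp_deriv[OF this] assms[unfolded tangent_space_def mem_Collect_eq, rule_format, OF 1]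
  show "a * (p$1 * v$3 + v$1 * p$3) + b * (p$1 * v$4 + v$1 * p$4) + c * (p$2 * v$3 + v$2 * p$3)
      + d * (p$2 * v$4 + v$2 * p$4) = 0" by simp
  have "((\<lambda>z. quad2 e f g h (p + z *s v)) has_field_derivative
     (e * (p$1 * v$2 + v$1 * p$2) + f * (p$1 * v$4 + v$1 * p$4) + g * (p$2 * v$3 + v$2 * p$3)
      + h * (p$3 * v$4 + v$3 * p$4))) (at 0)"
    unfolding quad2_def by (auto intro!: derivative_eq_intros simp: algebra_simps)
  from DERIV_imp_deriv[OF this] assms[unfolded tangent_space_def mem_Collect_eq, rule_format, OF 2]
  show "e * (p$1 * v$2 + v$1 * p$2) + f * (p$1 * v$4 + v$1 * p$4) + g * (p$2 * v$3 + v$2 * p$3)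
      + h * (p$3 * v$4 + v$3 * p$4) = 0" by simp
qed

lemma real_form_map_vec4:
  assumes "(\<lambda>x. f1 (fst x) (snd x)) \<in> polyfun coords2" "(\<lambda>x. f2 (fst x) (snd x)) \<in> polyfun coords2"
    "(\<lambda>x. f3 (fst x) (snd x)) \<in> polyfun coords2" "(\<lambda>x. f4 (fst x) (snd x)) \<in> polyfun coords2"
    and "d > 0" "\<And>c s t. f1 (c * s) (c * t) = c ^ d * f1 s t" "\<And>c s t. f2 (c * s) (c * t) = c ^ d * f2 s t"
    "\<And>c s t. f3 (c * s) (c * t) = c ^ d * f3 s t" "\<And>c s t. f4 (c * s) (c * t) = c ^ d * f4 s t"
    and "\<And>s t. s \<in> \<real> \<Longrightarrow> t \<in> \<real> \<Longrightarrow> f1 s t \<in> \<real> \<and> f2 s t \<in> \<real> \<and> f3 s t \<in> \<real> \<and> f4 s t \<in> \<real>"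
  shows "real_form_map (\<lambda>(s, t). vec4 (f1 s t) (f2 s t) (f3 s t) (f4 s t))"
  unfolding real_form_map_def polymap_def
proof (intro conjI)
  show "\<forall>i. (\<lambda>x. (case x of (s, t) \<Rightarrow> vec4 (f1 s t) (f2 s t) (f3 s t) (f4 s t)) $ i) \<in> polyfun coords2"
    using assms(1-4) by (simp add: forall_4 case_prod_beta)
  show "\<exists>d>0. \<forall>c s t. (case (c * s, c * t) of (s, t) \<Rightarrow> vec4 (f1 s t) (f2 s t) (f3 s t) (f4 s t)) =
      c ^ d *s (case (s, t) of (s, t) \<Rightarrow> vec4 (f1 s t) (f2 s t) (f3 s t) (f4 s t))"
    by (rule exI[of _ d]) (simp add: assms(5-9) vec4_eq_iff)
  show "\<forall>s\<in>\<real>. \<forall>t\<in>\<real>. \<forall>i. (case (s, t) of (s, t) \<Rightarrow> vec4 (f1 s t) (f2 s t) (f3 s t) (f4 s t)) $ i \<in> \<real>"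
    using assms(10) by (simp add: forall_4)
qed

text \<open>One nonzero minor of the point and its velocity shows both that the point is nonzero and
  that the two vectors are independent.\<close>

lemma smooth_witness_vec4:
  assumes "s \<in> \<real>" "t \<in> \<real>"
    and "((\<lambda>z. f1 s (t + z)) has_field_derivative w1) (at 0)" "((\<lambda>z. f2 s (t + z)) has_field_derivative w2) (at 0)"
    "((\<lambda>z. f3 s (t + z)) has_field_derivative w3) (at 0)" "((\<lambda>z. f4 s (t + z)) has_field_derivative w4) (at 0)"
    and minor: "vec4 (f1 s t) (f2 s t) (f3 s t) (f4 s t) $ j * vec4 w1 w2 w3 w4 $ k
      \<noteq> vec4 (f1 s t) (f2 s t) (f3 s t) (f4 s t) $ k * vec4 w1 w2 w3 w4 $ j"
    and span: "\<And>v. v \<in> tangent_space V (vec4 (f1 s t) (f2 s t) (f3 s t) (f4 s t)) \<Longrightarrow>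
      \<exists>x y. v$1 = x * f1 s t + y * w1 \<and> v$2 = x * f2 s t + y * w2 \<and> v$3 = x * f3 s t + y * w3 \<and> v$4 = x * f4 s t + y * w4"
  shows "smooth_witness V (\<lambda>(s, t). vec4 (f1 s t) (f2 s t) (f3 s t) (f4 s t))"
  unfolding smooth_witness_def
proof (rule bexI[OF _ assms(1)], rule bexI[OF _ assms(2)], rule exI[of _ "vec4 w1 w2 w3 w4"], intro conjI allI ballI)
  let ?p = "vec4 (f1 s t) (f2 s t) (f3 s t) (f4 s t)"
  show "(case (s, t) of (s, t) \<Rightarrow> vec4 (f1 s t) (f2 s t) (f3 s t) (f4 s t)) \<noteq> 0"
  proof
    assume "(case (s, t) of (s, t) \<Rightarrow> vec4 (f1 s t) (f2 s t) (f3 s t) (f4 s t)) = 0"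
    then have "?p = 0" by simp
    then show False using minor by simp
  qed
  show "vec4 w1 w2 w3 w4 \<noteq> c *s (case (s, t) of (s, t) \<Rightarrow> vec4 (f1 s t) (f2 s t) (f3 s t) (f4 s t))" for c
  proof
    assume "vec4 w1 w2 w3 w4 = c *s (case (s, t) of (s, t) \<Rightarrow> vec4 (f1 s t) (f2 s t) (f3 s t) (f4 s t))"
    then have "vec4 w1 w2 w3 w4 = c *s ?p" by simp
    then show False using minor by simp
  qed
  show "((\<lambda>z. (case (s, t + z) of (s, t) \<Rightarrow> vec4 (f1 s t) (f2 s t) (f3 s t) (f4 s t)) $ i)
      has_field_derivative vec4 w1 w2 w3 w4 $ i) (at 0)" for i
    using assms(3-6) exhaust_4[of i] by auto
  fix v assume "v \<in> tangent_space V (case (s, t) of (s, t) \<Rightarrow> vec4 (f1 s t) (f2 s t) (f3 s t) (f4 s t))"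
  then show "\<exists>x y. v = x *s (case (s, t) of (s, t) \<Rightarrow> vec4 (f1 s t) (f2 s t) (f3 s t) (f4 s t)) + y *s vec4 w1 w2 w3 w4"
    using span by (simp add: vec4_eq_iff)
qed

lemma ex2I: "P x y \<Longrightarrow> \<exists>x y. P x y" and ex3I: "Q x y z \<Longrightarrow> \<exists>x y z. Q x y z"
  by blast+

text \<open>\<open>m\<close> is the multiplier with which a linear relation first arises as a
  polynomial combination of the tangent equations.\<close>

lemma solve_linear:
  fixes x :: "'a::field"
  assumes "m * (k * x + y) = 0" "m \<noteq> 0" "k \<noteq> 0"
  shows "x = - (y / k)"
proof -
  have "k * x = - y" using assms by (simp add: eq_neg_iff_add_eq_0)
  then show ?thesis using assms(3) by (simp add: field_simps)
qed

lemmas polyfun_coords2_intros = polyfun_intros polyfun_fst polyfun_snd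

text \<open>The first quadric is a pair of planes, so the cone is a union of two plane conics.\<close>

lemma real_rational_cone_two_conics:
  assumes real: "a \<in> \<real>" "b \<in> \<real>" "c \<in> \<real>" "d \<in> \<real>" "e \<in> \<real>" "f \<in> \<real>" "g \<in> \<real>" "h \<in> \<real>"
    and ad: "a * d = b * c" and nz: "a \<noteq> 0" "b \<noteq> 0" "c \<noteq> 0" "d \<noteq> 0" "e \<noteq> 0" "h \<noteq> 0" and eh: "e * h \<noteq> f * g"
  shows "real_rational_cone (quad_cone a b c d e f g h)" (is "real_rational_cone ?V")
proof -
  \<comment> \<open>Projection of a conic from a coordinate point. With \<open>p$1 = c * u\<close>
    and \<open>p$2 = - a * u\<close> the second quadric is linear in \<open>p$3\<close>; it is
    solved with \<open>s = p$4\<close>, \<open>t = u\<close>, and denominators are cleared.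
    \<open>\<phi>2\<close> solves for \<open>p$1\<close> on the other plane in the same way.\<close>
  define \<phi>1 where "\<phi>1 = (\<lambda>(s, t). vec4 (c * t * (h * s - a * g * t)) (- a * t * (h * s - a * g * t))
    (- c * t * (f * s - a * e * t)) (s * (h * s - a * g * t)))"
  define \<phi>2 where "\<phi>2 = (\<lambda>(s, t). vec4 (- b * t * (g * s - a * h * t)) (s * (e * s - a * f * t))
    (b * t * (e * s - a * f * t)) (- a * t * (e * s - a * f * t)))"
  have d: "d = b * c / a" using ad nz by (simp add: field_simps)
  have "real_form_map \<phi>1" unfolding \<phi>1_def
    by (rule real_form_map_vec4[where d=2])
      (use real in \<open>auto intro!: polyfun_coords2_intros Reals_mult Reals_add Reals_diff Reals_minus simp: algebra_simps power2_eq_square\<close>)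
  moreover have "real_form_map \<phi>2" unfolding \<phi>2_def
    by (rule real_form_map_vec4[where d=2])
      (use real in \<open>auto intro!: polyfun_coords2_intros Reals_mult Reals_add Reals_diff Reals_minus simp: algebra_simps power2_eq_square\<close>)
  moreover have "range \<phi>1 \<subseteq> ?V" "range \<phi>2 \<subseteq> ?V"
    using nz by (auto simp: \<phi>1_def \<phi>2_def quad_cone_def quad1_def quad2_def d field_simps)
  moreover have "smooth_witness ?V \<phi>1" unfolding \<phi>1_def
  proof (rule smooth_witness_vec4[where s=1 and t=0 and j=4 and k=2 and ?w1.0="c * h"
      and ?w2.0="- a * h" and ?w3.0="- c * f" and ?w4.0="- a * g"], goal_cases)
    case (8 v)
    note T = tangent_space_quad_cone[OF 8, simplified]
    have "h * b * (c * v$2 + a * v$1) = 0" "h * (h * v$3 + f * v$1) = 0" using T ad by algebra+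
    then have "v$2 = - (a * v$1 / c)" "v$3 = - (f * v$1 / h)"
      using nz by (auto intro: solve_linear)
    then show ?case
      using nz by (intro ex2I[of _ "(v$4 + a * g * v$1 / (c * h)) / h" "v$1 / (c * h)"]) (auto simp: field_simps)
  qed (use nz in \<open>auto intro!: derivative_eq_intros\<close>)
  moreover have "smooth_witness ?V \<phi>2" unfolding \<phi>2_def
  proof (rule smooth_witness_vec4[where s=1 and t=0 and j=2 and k=3 and ?w1.0="- b * g"
      and ?w2.0="- a * f" and ?w3.0="b * e" and ?w4.0="- a * e"], goal_cases)
    case (8 v)
    note T = tangent_space_quad_cone[OF 8, simplified]
    have "e * c * (b * v$4 + a * v$3) = 0" "e * (e * v$1 + g * v$3) = 0" using T ad by algebra+
    then have "v$4 = - (a * v$3 / b)" "v$1 = - (g * v$3 / e)"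
      using nz by (auto intro: solve_linear)
    then show ?case
      using nz by (intro ex2I[of _ "(v$2 + a * f * v$3 / (b * e)) / e" "v$3 / (b * e)"]) (auto simp: field_simps)
  qed (use nz in \<open>auto intro!: derivative_eq_intros\<close>)
  moreover have "\<exists>\<phi>\<in>{\<phi>1, \<phi>2}. \<exists>k s t. p = k *s \<phi> (s, t)" if p: "p \<in> ?V" "p \<noteq> 0" for p
  proof -
    have q1: "quad1 a b c d p = 0" and q2: "quad2 e f g h p = 0" using p by (auto simp: quad_cone_def)
    have "(a * p$1 + c * p$2) * (a * p$3 + b * p$4) = a * quad1 a b c d p"
      using nz by (simp add: quad1_def d field_simps)
    then consider "a * p$1 + c * p$2 = 0" | "a * p$3 + b * p$4 = 0" using q1 by auto
    then show ?thesis
    proof cases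
      case 1
      define u where "u = - p$2 / a"
      have u: "p$1 = c * u" "p$2 = - a * u"
        using 1 nz by (auto simp: u_def field_simps add_eq_0_iff)
      have L: "p$3 * (h * p$4 - a * g * u) = - c * u * (f * p$4 - a * e * u)"
        using q2 by (simp add: quad2_def u algebra_simps add_eq_0_iff)
      consider "h * p$4 - a * g * u \<noteq> 0" | "p$4 = 0" "u = 0" | "h * p$4 - a * g * u = 0" "u \<noteq> 0"
        using nz by fastforce
      then have "\<exists>k s t. p = k *s \<phi>1 (s, t)"
      proof cases
        case 1
        then show ?thesis using L
          by (intro ex3I[of _ "1 / (h * p$4 - a * g * u)" "p$4" u])
            (simp add: vec4_eq_iff \<phi>1_def u field_simps)
      next
        \<comment> \<open>The center of projection is reached where \<open>h * s - a * g * t\<close>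
          vanishes; \<open>eh\<close> keeps the third coordinate nonzero there.\<close>
        case 2
        then show ?thesis using nz eh u
          by (intro ex3I[of _ "p$3 / (c * h * a * (e * h - f * g))" "a * g" h])
            (auto simp: vec4_eq_iff \<phi>1_def field_simps)
      next
        case 3
        then have "f * p$4 = a * e * u" "h * p$4 = a * g * u" using L nz by auto
        then have "(e * h - f * g) * (a * u) = 0" by algebra
        then show ?thesis using eh nz 3 by simp
      qed
      then show ?thesis by blast
    next
      case 2
      define u where "u = - p$4 / a"
      have u: "p$3 = b * u" "p$4 = - a * u"
        using 2 nz by (auto simp: u_def field_simps add_eq_0_iff)
      have L: "p$1 * (e * p$2 - a * f * u) = - b * u * (g * p$2 - a * h * u)"
        using q2 by (simp add: quad2_def u algebra_simps add_eq_0_iff)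
      consider "e * p$2 - a * f * u \<noteq> 0" | "p$2 = 0" "u = 0" | "e * p$2 - a * f * u = 0" "u \<noteq> 0"
        using nz by fastforce
      then have "\<exists>k s t. p = k *s \<phi>2 (s, t)"
      proof cases
        case 1
        then show ?thesis using L
          by (intro ex3I[of _ "1 / (e * p$2 - a * f * u)" "p$2" u])
            (simp add: vec4_eq_iff \<phi>2_def u field_simps)
      next
        case 2
        then show ?thesis using nz eh u
          by (intro ex3I[of _ "p$1 / (b * e * a * (e * h - f * g))" "a * f" e])
            (auto simp: vec4_eq_iff \<phi>2_def field_simps)
      next
        case 3
        then have "g * p$2 = a * h * u" "e * p$2 = a * f * u" using L nz by auto
        then have "(e * h - f * g) * (a * u) = 0" by algebra
        then show ?thesis using eh nz 3 by simp
      qed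
      then show ?thesis by blast
    qed
  qed
  ultimately show ?thesis unfolding real_rational_cone_def by (intro exI[of _ "{\<phi>1, \<phi>2}"]) simp
qed

text \<open>The cone contains the plane over the line \<open>p\<^sub>1\<^sub>2 = p\<^sub>2\<^sub>2 = 0\<close>. For a fixed ratio \<open>s : t\<close> of
  \<open>p\<^sub>1\<^sub>2\<close> and \<open>p\<^sub>2\<^sub>2\<close> both quadrics become linear, and solving them parametrizes the residual cubic.\<close>

lemma real_rational_cone_axis_line_cubic:
  assumes real: "b \<in> \<real>" "c \<in> \<real>" "d \<in> \<real>" "e \<in> \<real>" "f \<in> \<real>" "g \<in> \<real>" "h \<in> \<real>"
    and nz: "b \<noteq> 0" "c \<noteq> 0" "d \<noteq> 0" "e \<noteq> 0" "h \<noteq> 0" and eh: "e * h \<noteq> f * g"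
  shows "real_rational_cone (quad_cone 0 b c d e f g h)" (is "real_rational_cone ?V")
proof -
  define \<phi>1 :: "complex \<times> complex \<Rightarrow> complex^4" where "\<phi>1 = (\<lambda>(s, t). vec4 s 0 t 0)"
  \<comment> \<open>For fixed \<open>s = p$2\<close> and \<open>t = p$4\<close> the quadrics are two
    linear equations in \<open>p$1\<close> and \<open>p$3\<close>; \<open>N\<close> is minus their
    determinant, and \<open>\<phi>2\<close> is Cramer's rule.\<close>
  define N where "N = (\<lambda>s t. c * s * (e * s + f * t) - b * t * (g * s + h * t))"
  define \<phi>2 where "\<phi>2 = (\<lambda>(s, t). vec4 (d * s * t * (g * s + h * t)) (s * N s t)
    (- d * s * t * (e * s + f * t)) (t * N s t))"
  have "real_form_map \<phi>1" unfolding \<phi>1_def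
    by (rule real_form_map_vec4[where d=1]) (auto intro!: polyfun_coords2_intros)
  moreover have "real_form_map \<phi>2" unfolding \<phi>2_def N_def
    by (rule real_form_map_vec4[where d=3])
      (use real in \<open>auto intro!: polyfun_coords2_intros Reals_mult Reals_add Reals_diff Reals_minus simp: algebra_simps power3_eq_cube\<close>)
  moreover have "range \<phi>1 \<subseteq> ?V" "range \<phi>2 \<subseteq> ?V"
    by (auto simp: \<phi>1_def \<phi>2_def N_def quad_cone_def quad1_def quad2_def algebra_simps)
  moreover have "smooth_witness ?V \<phi>1" unfolding \<phi>1_def
  proof (rule smooth_witness_vec4[where s=1 and t=0 and j=1 and k=3 and ?w1.0=0
      and ?w2.0=0 and ?w3.0=1 and ?w4.0=0], goal_cases)
    case (8 v)
    note T = tangent_space_quad_cone[OF 8, simplified]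
    then show ?case using nz by auto
  qed (auto intro!: derivative_eq_intros)
  moreover have "smooth_witness ?V \<phi>2" unfolding \<phi>2_def N_def
  proof (rule smooth_witness_vec4[where s=1 and t=0 and j=2 and k=4 and ?w1.0="d * g"
      and ?w2.0="c * f - b * g" and ?w3.0="- d * e" and ?w4.0="c * e"], goal_cases)
    case (8 v)
    note T = tangent_space_quad_cone[OF 8, simplified]
    have "c * e * (c * v$3 + d * v$4) = 0" "c * c * e * (c * e * v$1 - d * g * v$4) = 0"
      using T by algebra+
    then have "v$3 = - (d * v$4 / c)" "c * e * v$1 = d * g * v$4"
      using nz by (auto intro: solve_linear)
    then show ?case using nz
      by (intro ex2I[of _ "(v$2 - v$4 / (c * e) * (c * f - b * g)) / (c * e)" "v$4 / (c * e)"])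
        (simp add: field_simps)
  qed (use nz in \<open>auto intro!: derivative_eq_intros simp: algebra_simps\<close>)
  moreover have "\<exists>\<phi>\<in>{\<phi>1, \<phi>2}. \<exists>k s t. p = k *s \<phi> (s, t)" if p: "p \<in> ?V" "p \<noteq> 0" for p
  proof (cases "p$2 = 0 \<and> p$4 = 0")
    case True
    then have "p = 1 *s \<phi>1 (p$1, p$3)" by (simp add: vec4_eq_iff \<phi>1_def)
    then show ?thesis by blast
  next
    case False
    define s t where "s = p$2" and "t = p$4"
    have q1: "s * (c * p$3 + d * t) + t * b * p$1 = 0"
      and q2: "p$1 * (e * s + f * t) + p$3 * (g * s + h * t) = 0"
      using p by (auto simp: quad_cone_def quad1_def quad2_def s_def t_def algebra_simps)
    have eq: "p$1 * N s t = d * s * t * (g * s + h * t)" "p$3 * N s t = - d * s * t * (e * s + f * t)"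
      unfolding N_def using q1 q2 by algebra+
    \<comment> \<open>At a zero of \<open>N\<close> Cramer's rule would force both coefficients of
      the second linear equation to vanish, which \<open>eh\<close> excludes.\<close>
    have "N s t \<noteq> 0"
    proof
      assume N: "N s t = 0"
      have "s * t \<noteq> 0"
      proof
        assume "s * t = 0"
        then consider "s = 0" "t \<noteq> 0" | "t = 0" "s \<noteq> 0" using False by (auto simp: s_def t_def)
        then show False using N nz by cases (auto simp: N_def)
      qed
      then have "g * s + h * t = 0" "e * s + f * t = 0" using eq nz N by auto
      then have "(e * h - f * g) * s = 0" "(e * h - f * g) * t = 0" by algebra+
      then show False using eh False by (auto simp: s_def t_def)
    qed
    then have "p = (1 / N s t) *s \<phi>2 (s, t)" using eq
      by (simp add: vec4_eq_iff \<phi>2_def field_simps) (simp add: s_def t_def)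
    then show ?thesis by blast
  qed
  ultimately show ?thesis unfolding real_rational_cone_def by (intro exI[of _ "{\<phi>1, \<phi>2}"]) simp
qed

text \<open>Without \<open>p$2 * p$3\<close> terms both quadrics contain the line
  \<open>p$1 = p$4 = 0\<close>. Fixing \<open>p$1\<close> and \<open>p$4\<close> leaves a linear
  system in the other two with determinant \<open>D\<close>; \<open>res\<close> ensures that
  \<open>D\<close> and both Cramer numerators never vanish together where
  \<open>s * t \<noteq> 0\<close>.\<close>

lemma real_rational_cone_diagonal_line_cubic:
  assumes real: "a \<in> \<real>" "b \<in> \<real>" "d \<in> \<real>" "e \<in> \<real>" "f \<in> \<real>" "h \<in> \<real>"
    and nz: "a \<noteq> 0" "d \<noteq> 0" "e \<noteq> 0" "h \<noteq> 0" and res: "a * d * f\<^sup>2 \<noteq> e * h * b\<^sup>2"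
  shows "real_rational_cone (quad_cone a b 0 d e f 0 h)" (is "real_rational_cone ?V")
proof -
  define \<phi>1 :: "complex \<times> complex \<Rightarrow> complex^4" where "\<phi>1 = (\<lambda>(s, t). vec4 0 s t 0)"
  define D where "D = (\<lambda>s t. d * h * t * t - a * e * s * s)"
  define \<phi>2 where "\<phi>2 = (\<lambda>(s, t). vec4 (s * D s t) (s * t * (a * f * s - b * h * t))
    (s * t * (b * e * s - d * f * t)) (t * D s t))"
  have "real_form_map \<phi>1" unfolding \<phi>1_def
    by (rule real_form_map_vec4[where d=1]) (auto intro!: polyfun_coords2_intros)
  moreover have "real_form_map \<phi>2" unfolding \<phi>2_def D_def
    by (rule real_form_map_vec4[where d=3])
      (use real in \<open>auto intro!: polyfun_coords2_intros Reals_mult Reals_add Reals_diff Reals_minus simp: algebra_simps power3_eq_cube\<close>)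
  moreover have "range \<phi>1 \<subseteq> ?V" "range \<phi>2 \<subseteq> ?V"
    by (auto simp: \<phi>1_def \<phi>2_def D_def quad_cone_def quad1_def quad2_def algebra_simps)
  moreover have "smooth_witness ?V \<phi>1" unfolding \<phi>1_def
  proof (rule smooth_witness_vec4[where s=1 and t=0 and j=2 and k=3 and ?w1.0=0
      and ?w2.0=0 and ?w3.0=1 and ?w4.0=0], goal_cases)
    case (8 v)
    note T = tangent_space_quad_cone[OF 8, simplified]
    then show ?case using nz by auto
  qed (auto intro!: derivative_eq_intros)
  moreover have "smooth_witness ?V \<phi>2" unfolding \<phi>2_def D_def
  proof (rule smooth_witness_vec4[where s=1 and t=0 and j=1 and k=4 and ?w1.0=0
      and ?w2.0="a * f" and ?w3.0="b * e" and ?w4.0="- a * e"], goal_cases)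
    case (8 v)
    note T = tangent_space_quad_cone[OF 8, simplified]
    have "a * e * (a * v$3 + b * v$4) = 0" "a * e * (e * v$2 + f * v$4) = 0"
      using T by algebra+
    then have "v$3 = - (b * v$4 / a)" "v$2 = - (f * v$4 / e)"
      using nz by (auto intro: solve_linear)
    then show ?case using nz
      by (intro ex2I[of _ "- v$1 / (a * e)" "- v$4 / (a * e)"])
        (simp add: field_simps)
  qed (use nz in \<open>auto intro!: derivative_eq_intros simp: algebra_simps\<close>)
  moreover have "\<exists>\<phi>\<in>{\<phi>1, \<phi>2}. \<exists>k s t. p = k *s \<phi> (s, t)" if p: "p \<in> ?V" "p \<noteq> 0" for p
  proof (cases "p$1 = 0 \<and> p$4 = 0")
    case True
    then have "p = 1 *s \<phi>1 (p$2, p$3)" by (simp add: vec4_eq_iff \<phi>1_def)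
    then show ?thesis by blast
  next
    case False
    define s t where "s = p$1" and "t = p$4"
    have q1: "d * t * p$2 + a * s * p$3 + b * s * t = 0"
      and q2: "e * s * p$2 + h * t * p$3 + f * s * t = 0"
      using p by (auto simp: quad_cone_def quad1_def quad2_def s_def t_def algebra_simps)
    have eq: "p$2 * D s t = s * t * (a * f * s - b * h * t)" "p$3 * D s t = s * t * (b * e * s - d * f * t)"
      unfolding D_def using q1 q2 by algebra+
    have "D s t \<noteq> 0"
    proof
      assume D: "D s t = 0"
      have st: "s * t \<noteq> 0"
      proof
        assume "s * t = 0"
        then consider "s = 0" "t \<noteq> 0" | "t = 0" "s \<noteq> 0" using False by (auto simp: s_def t_def)
        then show False using D nz by cases (auto simp: D_def)
      qed
      then have "a * f * s = b * h * t" "b * e * s = d * f * t" using eq D by auto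
      then have "(a * d * f\<^sup>2 - e * h * b\<^sup>2) * (s * t) = 0" by algebra
      then show False using res st by simp
    qed
    then have "p = (1 / D s t) *s \<phi>2 (s, t)" using eq
      by (simp add: vec4_eq_iff \<phi>2_def field_simps) (simp add: s_def t_def)
    then show ?thesis by blast
  qed
  ultimately show ?thesis unfolding real_rational_cone_def by (intro exI[of _ "{\<phi>1, \<phi>2}"]) simp
qed

text \<open>A combination of the two quadrics is divisible by \<open>p\<^sub>1\<^sub>1\<close>; the cofactor spans the plane of
  the conic.\<close>

lemma real_rational_cone_two_lines_conic:
  assumes real: "a \<in> \<real>" "b \<in> \<real>" "c \<in> \<real>" "e \<in> \<real>" "f \<in> \<real>" "g \<in> \<real>"
    and nz: "a \<noteq> 0" "b \<noteq> 0" "c \<noteq> 0" "e \<noteq> 0" "f \<noteq> 0" "g \<noteq> 0" and bg: "b * g \<noteq> c * f"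
  shows "real_rational_cone (quad_cone a b c 0 e f g 0)" (is "real_rational_cone ?V")
proof -
  \<comment> \<open>\<open>g\<close> times the first quadric minus \<open>c\<close> times the second
    is \<open>p$1 * (q * p$4 - c * e * p$2 + a * g * p$3)\<close>.\<close>
  define q where "q = b * g - c * f"
  have q: "q \<noteq> 0" "q \<in> \<real>" using bg real by (auto simp: q_def)
  define \<phi>1 :: "complex \<times> complex \<Rightarrow> complex^4" where "\<phi>1 = (\<lambda>(s, t). vec4 0 s 0 t)"
  define \<phi>2 :: "complex \<times> complex \<Rightarrow> complex^4" where "\<phi>2 = (\<lambda>(s, t). vec4 0 0 s t)"
  \<comment> \<open>On the plane of the cofactor the conic reads
    \<open>p$1 * M (p$3) (p$2) = - q * p$2 * p$3\<close>; it is projected from the first coordinate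
    point.\<close>
  define M where "M = (\<lambda>s t. b * e * t - a * f * s)"
  define \<phi>3 where "\<phi>3 = (\<lambda>(s, t). vec4 (- q * q * s * t) (q * t * M s t) (q * s * M s t)
    ((c * e * t - a * g * s) * M s t))"
  have "real_form_map \<phi>1" "real_form_map \<phi>2" unfolding \<phi>1_def \<phi>2_def
    by (rule real_form_map_vec4[where d=1]; auto intro!: polyfun_coords2_intros)+
  moreover have "real_form_map \<phi>3" unfolding \<phi>3_def M_def
    by (rule real_form_map_vec4[where d=2])
      (use real q in \<open>auto intro!: polyfun_coords2_intros Reals_mult Reals_add Reals_diff Reals_minus simp: algebra_simps power2_eq_square\<close>)
  moreover have "range \<phi>1 \<subseteq> ?V" "range \<phi>2 \<subseteq> ?V" "range \<phi>3 \<subseteq> ?V"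
    by (auto simp: \<phi>1_def \<phi>2_def \<phi>3_def M_def q_def quad_cone_def quad1_def quad2_def algebra_simps)
  moreover have "smooth_witness ?V \<phi>1" unfolding \<phi>1_def
  proof (rule smooth_witness_vec4[where s=1 and t=0 and j=2 and k=4 and ?w1.0=0
      and ?w2.0=0 and ?w3.0=0 and ?w4.0=1], goal_cases)
    case (8 v)
    note T = tangent_space_quad_cone[OF 8, simplified]
    then show ?case using nz by auto
  qed (auto intro!: derivative_eq_intros)
  moreover have "smooth_witness ?V \<phi>2" unfolding \<phi>2_def
  proof (rule smooth_witness_vec4[where s=1 and t=0 and j=3 and k=4 and ?w1.0=0
      and ?w2.0=0 and ?w3.0=0 and ?w4.0=1], goal_cases)
    case (8 v)
    note T = tangent_space_quad_cone[OF 8, simplified]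
    then show ?case using nz by auto
  qed (auto intro!: derivative_eq_intros)
  moreover have "smooth_witness ?V \<phi>3" unfolding \<phi>3_def M_def
  \<comment> \<open>These parameters are a zero of \<open>M\<close> and give the first coordinate
    point. The usual choice \<open>s = 1\<close>, \<open>t = 0\<close> would land on the line of
    \<open>\<phi>2\<close>, where two components meet.\<close>
  proof (rule smooth_witness_vec4[where s="b * e" and t="a * f" and j=1 and k=2 and ?w1.0="- q * q * b * e"
      and ?w2.0="q * a * f * b * e" and ?w3.0="q * b * e * b * e" and ?w4.0="- a * e * q * b * e"], goal_cases)
    case (8 v)
    have M0: "b * e * (a * f) - a * f * (b * e) = 0" by simp
    have p: "vec4 (- q * q * (b * e) * (a * f)) (q * (a * f) * (b * e * (a * f) - a * f * (b * e)))
       (q * (b * e) * (b * e * (a * f) - a * f * (b * e)))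
       ((c * e * (a * f) - a * g * (b * e)) * (b * e * (a * f) - a * f * (b * e)))
      = vec4 (- q * q * (b * e) * (a * f)) 0 0 0" by (simp add: vec4_eq_iff)
    note T = tangent_space_quad_cone[OF 8[unfolded p], simplified]
    define r where "r = q * q * b * e * a * f"
    have r: "r \<noteq> 0" using nz q by (simp add: r_def)
    have "r * (a * v$3 + b * v$4) = 0" "r * (e * v$2 + f * v$4) = 0"
      unfolding r_def using T by algebra+
    then have "v$3 = - (b * v$4 / a)" "v$2 = - (f * v$4 / e)"
      using nz r by (auto intro: solve_linear)
    then show ?case unfolding M0 mult_zero_right add_0_left using nz q
      by (intro ex2I[of _ "- (v$1 - q * v$4 / (a * e)) / (q * q * b * e * a * f)" "- v$4 / (a * e * q * b * e)"])
        (simp add: field_simps)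
  next
    case 6
    show ?case by (auto intro!: derivative_eq_intros simp: q_def algebra_simps)
  qed (use nz q real in \<open>auto intro!: derivative_eq_intros simp: algebra_simps\<close>)
  moreover have "\<exists>\<phi>\<in>{\<phi>1, \<phi>2, \<phi>3}. \<exists>k s t. p = k *s \<phi> (s, t)" if p: "p \<in> ?V" "p \<noteq> 0" for p
  proof -
    have q1: "a * p$1 * p$3 + b * p$1 * p$4 + c * p$2 * p$3 = 0"
      and q2: "e * p$1 * p$2 + f * p$1 * p$4 + g * p$2 * p$3 = 0"
      using p by (auto simp: quad_cone_def quad1_def quad2_def)
    show ?thesis
    proof (cases "p$1 = 0")
      case True
      then have "p$2 = 0 \<or> p$3 = 0" using q1 nz by auto
      then have "p = 1 *s \<phi>1 (p$2, p$4) \<or> p = 1 *s \<phi>2 (p$3, p$4)"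
        using True by (auto simp: vec4_eq_iff \<phi>1_def \<phi>2_def)
      then show ?thesis by blast
    next
      case False
      have "p$1 * (q * p$4 - (c * e * p$2 - a * g * p$3)) = 0" unfolding q_def using q1 q2 by algebra
      then have p4: "q * p$4 = c * e * p$2 - a * g * p$3" using False by simp
      have "c * (p$1 * M (p$3) (p$2) + q * p$2 * p$3) = 0"
        unfolding M_def using q1 q2 by (simp add: q_def) algebra
      then have p1: "p$1 * M (p$3) (p$2) = - q * p$2 * p$3" using nz by (simp add: add_eq_0_iff)
      have "\<exists>k s t. p = k *s \<phi>3 (s, t)"
      proof (cases "M (p$3) (p$2) = 0")
        case True
        then have z: "p$2 = 0" "p$3 = 0" using p1 q nz by (auto simp: M_def)
        then have "p$4 = 0" using p4 q by simp
        then show ?thesis using z nz q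
          by (intro ex3I[of _ "- p$1 / (q * q * b * e * a * f)" "b * e" "a * f"])
            (simp add: vec4_eq_iff \<phi>3_def M_def field_simps)
      next
        case False
        have "p = (1 / (q * M (p$3) (p$2))) *s \<phi>3 (p$3, p$2)"
          using False q p1 by (simp add: vec4_eq_iff \<phi>3_def p4[symmetric]) (simp add: field_simps)
        then show ?thesis by blast
      qed
      then show ?thesis by blast
    qed
  qed
  ultimately show ?thesis unfolding real_rational_cone_def by (intro exI[of _ "{\<phi>1, \<phi>2, \<phi>3}"]) simp
qed

text \<open>The equations say that the \<open>i\<close>-th coordinate is
  \<open>w_i * m / (t - s * r_i)\<close>; clearing denominators gives cubic forms. Distinct nodes
  let at most one factor vanish, so for \<open>m = 0\<close> a nonzero \<open>p\<close> is a
  coordinate point, attained at its own node.\<close>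

lemma rational_normal_cubic_cover:
  fixes p :: "complex^4"
  assumes r: "distinct [r1, r2, r3, r4]" and w: "w1 \<noteq> 0" "w2 \<noteq> 0" "w3 \<noteq> 0" "w4 \<noteq> 0"
    and st: "s \<noteq> 0 \<or> t \<noteq> 0"
    and p: "p$1 * (t - s * r1) = w1 * m" "p$2 * (t - s * r2) = w2 * m"
      "p$3 * (t - s * r3) = w3 * m" "p$4 * (t - s * r4) = w4 * m"
  shows "\<exists>k. p = k *s vec4 (w1 * (t - s * r2) * (t - s * r3) * (t - s * r4))
    (w2 * (t - s * r1) * (t - s * r3) * (t - s * r4))
    (w3 * (t - s * r1) * (t - s * r2) * (t - s * r4))
    (w4 * (t - s * r1) * (t - s * r2) * (t - s * r3))"
proof -
  define u1 u2 u3 u4 where u: "u1 = t - s * r1" "u2 = t - s * r2" "u3 = t - s * r3" "u4 = t - s * r4"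
  note p = p[folded u]
  have "\<not> (t - s * x = 0 \<and> t - s * y = 0)" if "x \<noteq> y" for x y
    using st that by auto
  then have one: "u1 \<noteq> 0 \<or> u2 \<noteq> 0" "u1 \<noteq> 0 \<or> u3 \<noteq> 0" "u1 \<noteq> 0 \<or> u4 \<noteq> 0" "u2 \<noteq> 0 \<or> u3 \<noteq> 0"
    "u2 \<noteq> 0 \<or> u4 \<noteq> 0" "u3 \<noteq> 0 \<or> u4 \<noteq> 0"
    using r by (auto simp: u)
  show ?thesis unfolding u[symmetric]
  proof (cases "m = 0")
    case False
    then have "u1 \<noteq> 0" "u2 \<noteq> 0" "u3 \<noteq> 0" "u4 \<noteq> 0" using p w by auto
    then show "\<exists>k. p = k *s vec4 (w1 * u2 * u3 * u4) (w2 * u1 * u3 * u4) (w3 * u1 * u2 * u4) (w4 * u1 * u2 * u3)"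
      using p by (intro exI[of _ "m / (u1 * u2 * u3 * u4)"]) (simp add: vec4_eq_iff field_simps)
  next
    case True
    then have z: "p$1 = 0 \<or> u1 = 0" "p$2 = 0 \<or> u2 = 0" "p$3 = 0 \<or> u3 = 0" "p$4 = 0 \<or> u4 = 0" using p by auto
    then consider "p = 0" | "u1 = 0" "p$2 = 0" "p$3 = 0" "p$4 = 0" | "u2 = 0" "p$1 = 0" "p$3 = 0" "p$4 = 0"
      | "u3 = 0" "p$1 = 0" "p$2 = 0" "p$4 = 0" | "u4 = 0" "p$1 = 0" "p$2 = 0" "p$3 = 0"
      using one by (auto simp: vec4_eq_iff)
    then show "\<exists>k. p = k *s vec4 (w1 * u2 * u3 * u4) (w2 * u1 * u3 * u4) (w3 * u1 * u2 * u4) (w4 * u1 * u2 * u3)"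
    proof cases
      case 1
      then show ?thesis by (intro exI[of _ 0]) simp
    next
      case 2
      then show ?thesis using one w by (intro exI[of _ "p$1 / (w1 * u2 * u3 * u4)"]) (simp add: vec4_eq_iff)
    next
      case 3
      then show ?thesis using one w by (intro exI[of _ "p$2 / (w2 * u1 * u3 * u4)"]) (simp add: vec4_eq_iff)
    next
      case 4
      then show ?thesis using one w by (intro exI[of _ "p$3 / (w3 * u1 * u2 * u4)"]) (simp add: vec4_eq_iff)
    next
      case 5
      then show ?thesis using one w by (intro exI[of _ "p$4 / (w4 * u1 * u2 * u3)"]) (simp add: vec4_eq_iff)
    qed
  qed
qed

text \<open>Payoff tables \<open>A = (0, k; a, b)\<close> and \<open>B = A\<close>. The conditional expected payoffs of all rows and
  columns agree with \<open>t / s\<close>, the ratio of the total payoff to the total mass; the line is where both totals vanish.\<close>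

lemma real_rational_cone_proportional_payoffs:
  assumes real: "a \<in> \<real>" "b \<in> \<real>" "k \<in> \<real>"
    and nz: "a \<noteq> 0" "b \<noteq> 0" "k \<noteq> 0" "a \<noteq> b" "a \<noteq> k" "b \<noteq> k"
  shows "real_rational_cone (quad_cone a b (a - k) (b - k) k b (k - a) (b - a))" (is "real_rational_cone ?V")
proof -
  define \<phi>1 where "\<phi>1 = (\<lambda>(s, t). vec4 ((a - k) * t + (b - k) * s) (- a * t - b * s) (k * t) (k * s))"
  \<comment> \<open>The nodes \<open>0, k, a, b\<close> are the payoffs of the four outcomes: the
    cubic passes through each coordinate point when \<open>t / s\<close> equals the payoff
    there.\<close>
  define \<phi>2 where "\<phi>2 = (\<lambda>(s, t). vec4 (1 * (t - s * k) * (t - s * a) * (t - s * b))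
    ((-1) * (t - s * 0) * (t - s * a) * (t - s * b))
    ((-1) * (t - s * 0) * (t - s * k) * (t - s * b))
    (1 * (t - s * 0) * (t - s * k) * (t - s * a)))"
  have "real_form_map \<phi>1" unfolding \<phi>1_def
    by (rule real_form_map_vec4[where d=1])
      (use real in \<open>auto intro!: polyfun_coords2_intros Reals_mult Reals_add Reals_diff Reals_minus simp: algebra_simps\<close>)
  moreover have "real_form_map \<phi>2" unfolding \<phi>2_def
    by (rule real_form_map_vec4[where d=3])
      (use real in \<open>auto intro!: polyfun_coords2_intros Reals_mult Reals_add Reals_diff Reals_minus simp: algebra_simps power3_eq_cube\<close>)
  moreover have "range \<phi>1 \<subseteq> ?V" "range \<phi>2 \<subseteq> ?V"
    by (auto simp: \<phi>1_def \<phi>2_def quad_cone_def quad1_def quad2_def algebra_simps)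
  moreover have "smooth_witness ?V \<phi>1" unfolding \<phi>1_def
  proof (rule smooth_witness_vec4[where s=1 and t=0 and j=3 and k=4 and ?w1.0="a - k"
      and ?w2.0="- a" and ?w3.0=k and ?w4.0=0], goal_cases)
    case (8 v)
    note T = tangent_space_quad_cone[OF 8, simplified]
    have "(b - k) * (k * v$2 + a * v$3 + b * v$4) = 0" using T by algebra
    then have v2: "k * v$2 + (a * v$3 + b * v$4) = 0" using nz by (simp add: add.assoc)
    moreover have "k * b * (v$1 + v$2 + v$3 + v$4) = k * (k * v$2 + a * v$3 + b * v$4)" using T by algebra
    ultimately have "k * b * (v$1 + v$2 + v$3 + v$4) = 0" by (simp add: add.assoc)
    then have "v$1 + v$2 + v$3 + v$4 = 0" using nz by simp
    then have v1: "v$1 = - v$2 - v$3 - v$4" by algebra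
    have v2: "v$2 = - ((a * v$3 + b * v$4) / k)" using v2 nz by (intro solve_linear[of 1]) auto
    show ?case unfolding v1 v2 using nz
      by (intro ex2I[of _ "v$4 / k" "v$3 / k"]) (simp add: field_simps)
  qed (use nz in \<open>auto intro!: derivative_eq_intros\<close>)
  moreover have "smooth_witness ?V \<phi>2" unfolding \<phi>2_def
  proof (rule smooth_witness_vec4[where s=1 and t=0 and j=1 and k=4 and ?w1.0="a * b + k * b + k * a"
      and ?w2.0="- a * b" and ?w3.0="- k * b" and ?w4.0="k * a"], goal_cases)
    case (8 v)
    note T = tangent_space_quad_cone[OF 8, simplified]
    have "(k * a * b) * (a * v$3 + b * v$4) = 0" "(k * a * b) * (k * v$2 + b * v$4) = 0"
      using T by algebra+
    then have "v$3 = - (b * v$4 / a)" "v$2 = - (b * v$4 / k)"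
      using nz by (auto intro: solve_linear)
    then show ?case using nz
      by (intro ex2I[of _ "- (v$1 - v$4 / (k * a) * (a * b + k * b + k * a)) / (k * a * b)" "v$4 / (k * a)"])
        (simp add: field_simps)
  qed (use nz in \<open>auto intro!: derivative_eq_intros simp: algebra_simps\<close>)
  moreover have "\<exists>\<phi>\<in>{\<phi>1, \<phi>2}. \<exists>c s t. p = c *s \<phi> (s, t)" if p: "p \<in> ?V" "p \<noteq> 0" for p
  proof -
    define s t where s: "s = p$1 + p$2 + p$3 + p$4" and t: "t = k * p$2 + a * p$3 + b * p$4"
    have q1: "quad1 a b (a - k) (b - k) p = 0" and q2: "quad2 k b (k - a) (b - a) p = 0"
      using p by (auto simp: quad_cone_def)
    show ?thesis
    proof (cases "s = 0 \<and> t = 0")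
      case True
      have p1: "p$1 = - p$2 - p$3 - p$4" using True s by algebra
      have p2: "p$2 = - ((a * p$3 + b * p$4) / k)"
        using True nz t by (intro solve_linear[of 1]) (auto simp: add.assoc)
      have "p = 1 *s \<phi>1 (p$4 / k, p$3 / k)"
        unfolding \<phi>1_def vec4_eq_iff p1 p2 using nz by (simp add: field_simps)
      then show ?thesis by blast
    next
      case False
      have "\<exists>c. p = c *s vec4 (1 * (t - s * k) * (t - s * a) * (t - s * b))
        ((-1) * (t - s * 0) * (t - s * a) * (t - s * b))
        ((-1) * (t - s * 0) * (t - s * k) * (t - s * b))
        (1 * (t - s * 0) * (t - s * k) * (t - s * a))"
      proof (rule rational_normal_cubic_cover[where m="p$1 * t"])
        \<comment> \<open>That the first row has conditional payoff \<open>t / s\<close> reads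
          \<open>k * p$2 * s = t * (p$1 + p$2)\<close>; the first column gives the equation for
          \<open>p$3\<close>, and the second row then that for \<open>p$4\<close>. Hence the signs
          of the weights.\<close>
        show "p$2 * (t - s * k) = - 1 * (p$1 * t)" "p$3 * (t - s * a) = - 1 * (p$1 * t)"
          "p$4 * (t - s * b) = 1 * (p$1 * t)"
          using q1 q2 unfolding quad1_def quad2_def s t by algebra+
      qed (use nz False in auto)
      then have "\<exists>c. p = c *s \<phi>2 (s, t)" by (simp add: \<phi>2_def)
      then show ?thesis by blast
    qed
  qed
  ultimately show ?thesis unfolding real_rational_cone_def by (intro exI[of _ "{\<phi>1, \<phi>2}"]) simp
qed

text \<open>Payoff tables \<open>A = (0, k; a, b)\<close> and \<open>B = (b, a; k, 0)\<close>.\<close>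

lemma real_rational_cone_rotated_payoffs:
  assumes real: "a \<in> \<real>" "b \<in> \<real>" "k \<in> \<real>"
    and nz: "a \<noteq> 0" "b \<noteq> 0" "k \<noteq> 0" "a \<noteq> b" "a \<noteq> k" "b \<noteq> k"
  shows "real_rational_cone (quad_cone a b (a - k) (b - k) (a - b) (- b) (a - k) (- k))" (is "real_rational_cone ?V")
proof -
  define \<phi>1 where "\<phi>1 = (\<lambda>(s, t). vec4 (k * s + t) (- t) (- b * s - t) (a * s + t))"
  define \<phi>2 where "\<phi>2 = (\<lambda>(s, t). vec4 ((- k) * (t - s * k) * (t - s * a) * (t - s * b))
    (k * (t - s * 0) * (t - s * a) * (t - s * b))
    ((b - a) * (t - s * 0) * (t - s * k) * (t - s * b))
    ((a - b) * (t - s * 0) * (t - s * k) * (t - s * a)))"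
  have "real_form_map \<phi>1" unfolding \<phi>1_def
    by (rule real_form_map_vec4[where d=1])
      (use real in \<open>auto intro!: polyfun_coords2_intros Reals_mult Reals_add Reals_diff Reals_minus simp: algebra_simps\<close>)
  moreover have "real_form_map \<phi>2" unfolding \<phi>2_def
    by (rule real_form_map_vec4[where d=3])
      (use real in \<open>auto intro!: polyfun_coords2_intros Reals_mult Reals_add Reals_diff Reals_minus simp: algebra_simps power3_eq_cube\<close>)
  moreover have "range \<phi>1 \<subseteq> ?V" "range \<phi>2 \<subseteq> ?V"
    by (auto simp: \<phi>1_def \<phi>2_def quad_cone_def quad1_def quad2_def algebra_simps)
  moreover have "smooth_witness ?V \<phi>1" unfolding \<phi>1_def
  proof (rule smooth_witness_vec4[where s=1 and t=0 and j=1 and k=2 and ?w1.0=1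
      and ?w2.0="- 1" and ?w3.0="- 1" and ?w4.0=1], goal_cases)
    case (8 v)
    note T = tangent_space_quad_cone[OF 8, simplified]
    have "k * (b * v$4 + (a * v$3 + (b - a) * v$2)) = 0" "a * (k * v$3 + (b * v$1 + (b - k) * v$2)) = 0"
      using T by algebra+
    then have v4: "v$4 = - ((a * v$3 + (b - a) * v$2) / b)" and v3: "v$3 = - ((b * v$1 + (b - k) * v$2) / k)"
      using nz by (auto intro: solve_linear)
    show ?case unfolding v4 v3 using nz
      by (intro ex2I[of _ "(v$1 + v$2) / k" "- v$2"]) (simp add: field_simps)
  qed (use nz in \<open>auto intro!: derivative_eq_intros\<close>)
  moreover have "smooth_witness ?V \<phi>2" unfolding \<phi>2_def
  proof (rule smooth_witness_vec4[where s=1 and t=0 and j=1 and k=2 and ?w1.0="- k * (a * b + k * b + k * a)"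
      and ?w2.0="k * a * b" and ?w3.0="(b - a) * k * b" and ?w4.0="(a - b) * k * a"], goal_cases)
    case (8 v)
    note T = tangent_space_quad_cone[OF 8, simplified]
    have "(k * k * a * b) * (b * v$4 + a * v$3) = 0" "(k * k * a * b) * (a * v$3 + (a - b) * v$2) = 0"
      using T by algebra+
    then have v4: "v$4 = - (a * v$3 / b)" and v3: "v$3 = - ((a - b) * v$2 / a)"
      using nz by (auto intro: solve_linear)
    then show ?case using nz unfolding v4 v3
      by (intro ex2I[of _ "(v$1 + v$2 * (a * b + k * b + k * a) / (a * b)) / (k * k * a * b)" "v$2 / (k * a * b)"])
        (simp add: field_simps)
  qed (use nz in \<open>auto intro!: derivative_eq_intros simp: algebra_simps\<close>)
  moreover have "\<exists>\<phi>\<in>{\<phi>1, \<phi>2}. \<exists>c s t. p = c *s \<phi> (s, t)" if p: "p \<in> ?V" "p \<noteq> 0" for p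
  proof -
    \<comment> \<open>\<open>t / s\<close> is again the conditional payoff of both rows of
      \<open>A\<close>. The rows are combined with weights \<open>b - a\<close> and
      \<open>k\<close>, so that both forms vanish on the line of \<open>\<phi>1\<close>.\<close>
    define s t where s: "s = (b - a) * (p$1 + p$2) + k * (p$3 + p$4)"
      and t: "t = k * ((b - a) * p$2 + a * p$3 + b * p$4)"
    have q1: "quad1 a b (a - k) (b - k) p = 0" and q2: "quad2 (a - b) (- b) (a - k) (- k) p = 0"
      using p by (auto simp: quad_cone_def)
    show ?thesis
    proof (cases "s = 0 \<and> t = 0")
      case True
      have "1 * (k * p$3 + ((b - a) * (p$1 + p$2) + k * p$4)) = 0" using True s by (simp add: algebra_simps)
      then have p3: "p$3 = - (((b - a) * (p$1 + p$2) + k * p$4) / k)" using nz by (intro solve_linear) auto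
      have "(b - a) * (k * p$4 + (k * p$2 - a * (p$1 + p$2))) = 0" using True s t by algebra
      then have p4: "p$4 = - ((k * p$2 - a * (p$1 + p$2)) / k)" using nz by (intro solve_linear) auto
      have "p = 1 *s \<phi>1 ((p$1 + p$2) / k, - p$2)"
        unfolding \<phi>1_def vec4_eq_iff p3 p4 using nz by (simp add: field_simps)
      then show ?thesis by blast
    next
      case False
      define m where "m = - p$1 * t / k"
      have m: "p$1 * t = - k * m" using nz by (simp add: m_def)
      have "\<exists>c. p = c *s vec4 ((- k) * (t - s * k) * (t - s * a) * (t - s * b))
        (k * (t - s * 0) * (t - s * a) * (t - s * b))
        ((b - a) * (t - s * 0) * (t - s * k) * (t - s * b))
        ((a - b) * (t - s * 0) * (t - s * k) * (t - s * a))"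
      proof (rule rational_normal_cubic_cover[where m=m])
        have "p$2 * (t - s * k) = - (p$1 * t)" "k * (p$3 * (t - s * a)) = - (b - a) * (p$1 * t)"
          "k * (p$4 * (t - s * b)) = - (a - b) * (p$1 * t)"
          using q1 q2 unfolding quad1_def quad2_def s t by algebra+
        then have "p$2 * (t - s * k) = k * m" "k * (p$3 * (t - s * a) - (b - a) * m) = 0"
          "k * (p$4 * (t - s * b) - (a - b) * m) = 0"
          unfolding m by (simp_all add: algebra_simps)
        then show "p$2 * (t - s * k) = k * m" "p$3 * (t - s * a) = (b - a) * m" "p$4 * (t - s * b) = (a - b) * m"
          using nz by auto
      qed (use nz False m in auto)
      then have "\<exists>c. p = c *s \<phi>2 (s, t)" by (simp add: \<phi>2_def)
      then show ?thesis by blast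
    qed
  qed
  ultimately show ?thesis unfolding real_rational_cone_def by (intro exI[of _ "{\<phi>1, \<phi>2}"]) simp
qed

section \<open>Spohn varieties\<close>

text \<open>Exchanging \<open>p$2\<close> and \<open>p$3\<close> exchanges the monomials of the two
  quadrics.\<close>

lemma real_rational_cone_swap_players:
  assumes "real_rational_cone (quad_cone e f g h a b c d)"
  shows "real_rational_cone (quad_cone a b c d e f g h)"
proof -
  define \<pi> :: "4 \<Rightarrow> 4" where "\<pi> = (\<lambda>i. if i = 2 then 3 else if i = 3 then 2 else i)"
  have "\<pi> (\<pi> i) = i" for i by (simp add: \<pi>_def)
  then have "real_rational_cone {p. (\<chi> i. p $ \<pi> i) \<in> quad_cone e f g h a b c d}"
    using real_rational_cone_permute[OF assms, of \<pi> \<pi>] by blast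
  also have "{p. (\<chi> i. p $ \<pi> i) \<in> quad_cone e f g h a b c d} = quad_cone a b c d e f g h"
    by (auto simp: quad_cone_def quad1_def quad2_def \<pi>_def algebra_simps)
  finally show ?thesis .
qed

text \<open>If a member of the pencil of the two quadrics is a product of a linear form in \<open>p\<^sub>1\<^sub>1, p\<^sub>2\<^sub>2\<close> and one
  in \<open>p\<^sub>1\<^sub>2, p\<^sub>2\<^sub>1\<close>, then permuting the coordinates reduces to a factorization of the first quadric.\<close>

lemma real_rational_cone_pencil_two_conics:
  assumes real: "a \<in> \<real>" "b \<in> \<real>" "c \<in> \<real>" "d \<in> \<real>" "a' \<in> \<real>" "b' \<in> \<real>" "c' \<in> \<real>" "d' \<in> \<real>"
    and pencil: "\<And>p. b * quad2 e f g h p - f * quad1 a b c d p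
      = f * (a' * p$1 * p$2 + b' * p$1 * p$3 + c' * p$4 * p$2 + d' * p$4 * p$3)"
    and prod: "a' * d' = b' * c'" "a' \<noteq> 0" "b' \<noteq> 0" "c' \<noteq> 0" "d' \<noteq> 0"
    and nz: "b \<noteq> 0" "c \<noteq> 0" "f \<noteq> 0" "b * c \<noteq> a * d"
  shows "real_rational_cone (quad_cone a b c d e f g h)"
proof -
  \<comment> \<open>The new coordinates are \<open>p$1, p$4, p$2, p$3\<close> in this order: the
    product becomes a first quadric, and the old first quadric becomes a second one with
    coefficients \<open>b, a, d, c\<close>.\<close>
  define \<pi> :: "4 \<Rightarrow> 4" where "\<pi> = (\<lambda>i. if i = 2 then 4 else if i = 3 then 2 else if i = 4 then 3 else i)"
  define \<rho> :: "4 \<Rightarrow> 4" where "\<rho> = (\<lambda>i. if i = 4 then 2 else if i = 2 then 3 else if i = 3 then 4 else i)"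
  let ?W = "quad_cone a' b' c' d' b a d c"
  have "real_rational_cone ?W"
    by (rule real_rational_cone_two_conics) (use assms in auto)
  moreover have "\<pi> (\<rho> i) = i" "\<rho> (\<pi> i) = i" for i using exhaust_4[of i] by (auto simp: \<pi>_def \<rho>_def)
  ultimately have "real_rational_cone {p. (\<chi> i. p $ \<pi> i) \<in> ?W}"
    by (rule real_rational_cone_permute)
  also have "{p. (\<chi> i. p $ \<pi> i) \<in> ?W} = quad_cone a b c d e f g h"
  proof (rule set_eqI)
    fix p :: "complex^4"
    have 1: "quad2 b a d c (\<chi> i. p $ \<pi> i) = quad1 a b c d p"
      by (simp add: quad1_def quad2_def \<pi>_def algebra_simps)
    have "f * quad1 a' b' c' d' (\<chi> i. p $ \<pi> i) = b * quad2 e f g h p - f * quad1 a b c d p"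
      unfolding pencil by (simp add: quad1_def \<pi>_def)
    then show "p \<in> {p. (\<chi> i. p $ \<pi> i) \<in> ?W} \<longleftrightarrow> p \<in> quad_cone a b c d e f g h"
      using 1 nz by (auto simp: quad_cone_def)
  qed
  finally show ?thesis .
qed

lemma quad_cone_cong_second:
  assumes "x \<noteq> 0" "y \<noteq> 0" "\<And>p. x * quad2 e f g h p = y * quad2 e' f' g' h' p"
  shows "quad_cone a b c d e f g h = quad_cone a b c d e' f' g' h'"
proof -
  have "quad2 e f g h p = 0 \<longleftrightarrow> quad2 e' f' g' h' p = 0" for p
    using assms(3)[of p] assms(1,2) by (metis mult_eq_0_iff)
  then show ?thesis by (simp add: quad_cone_def)
qed

definition spohn_cone :: "real^2^2 \<Rightarrow> real^2^2 \<Rightarrow> (complex^4) set" where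
  "spohn_cone A B = quad_cone
     (complex_of_real (A$2$1 - A$1$1)) (complex_of_real (A$2$2 - A$1$1))
     (complex_of_real (A$2$1 - A$1$2)) (complex_of_real (A$2$2 - A$1$2))
     (complex_of_real (B$1$2 - B$1$1)) (complex_of_real (B$2$2 - B$1$1))
     (complex_of_real (B$1$2 - B$2$1)) (complex_of_real (B$2$2 - B$2$1))"

lemma spohn_variety_eq: "spohn_variety A B = projectivize (spohn_cone A B)"
  unfolding spohn_variety_def projectivize_def spohn_cone_def quad_cone_def
  by (simp add: detM1_def detM2_def quad1_def quad2_def Let_def)

section \<open>Genericity and the twelve cases\<close>

definition generic_real_density :: "nat \<Rightarrow> bool" where
  "generic_real_density k \<longleftrightarrow> (\<exists>Z. zclosed payoff_coords Z \<and> \<not> case_variety k \<subseteq> Z \<and>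
     (\<forall>A B. (A, B) \<in> case_variety k - Z \<longrightarrow>
        (\<forall>Y. pcomponent (spohn_variety A B) Y \<longrightarrow>
              (\<exists>x\<in>Y. real_ppoint x \<and> psmooth (spohn_variety A B) x)) \<and>
        pclosure {x \<in> spohn_variety A B. real_ppoint x} = spohn_variety A B))"

text \<open>The exceptional set is a hypersurface: \<open>g\<close> will be the product of all
  quantities that have to be nonzero, and a single payoff pair shows that it does not contain the
  case variety.\<close>

lemma generic_real_densityI:
  assumes g: "g \<in> polyfun payoff_coords" and wit: "spohn_case k A0 B0" "g (A0, B0) \<noteq> 0"
    and cone: "\<And>A B. spohn_case k A B \<Longrightarrow> g (A, B) \<noteq> 0 \<Longrightarrow> real_rational_cone (spohn_cone A B)"
  shows "generic_real_density k"
  unfolding generic_real_density_def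
proof (intro exI[of _ "{x. g x = 0}"] conjI[of "zclosed _ _"] conjI[of "\<not> _"] allI impI)
  show "zclosed payoff_coords {x. g x = 0}" using zclosed_zero_set[OF g] .
  show "\<not> case_variety k \<subseteq> {x. g x = 0}" using wit by (auto simp: case_variety_def)
  fix A B assume "(A, B) \<in> case_variety k - {x. g x = 0}"
  then have "real_rational_cone (spohn_cone A B)" using cone by (auto simp: case_variety_def)
  then show "(\<forall>Y. pcomponent (spohn_variety A B) Y \<longrightarrow>
              (\<exists>x\<in>Y. real_ppoint x \<and> psmooth (spohn_variety A B) x)) \<and>
        pclosure {x \<in> spohn_variety A B. real_ppoint x} = spohn_variety A B"
    unfolding spohn_variety_eq
    by (intro real_rational_cone_components) (simp_all add: spohn_cone_def is_cone_quad_cone zclosed_quad_cone)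
qed

definition diffA :: "2 \<Rightarrow> 2 \<Rightarrow> 2 \<Rightarrow> 2 \<Rightarrow> (real^2^2) \<times> (real^2^2) \<Rightarrow> real" where
  "diffA i j k l x = fst x $ i $ j - fst x $ k $ l"

definition diffB :: "2 \<Rightarrow> 2 \<Rightarrow> 2 \<Rightarrow> 2 \<Rightarrow> (real^2^2) \<times> (real^2^2) \<Rightarrow> real" where
  "diffB i j k l x = snd x $ i $ j - snd x $ k $ l"

lemma polyfun_diffA: "(\<lambda>x. diffA i j k l x) \<in> polyfun payoff_coords"
proof -
  have "(\<lambda>x. fst x $ i $ j) \<in> polyfun payoff_coords" for i j
    by (rule polyfun.coord) (force simp: payoff_coords_def image_iff)
  then show ?thesis unfolding diffA_def by (intro polyfun_diff)
qed

lemma polyfun_diffB: "(\<lambda>x. diffB i j k l x) \<in> polyfun payoff_coords"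
proof -
  have "(\<lambda>x. snd x $ i $ j) \<in> polyfun payoff_coords" for i j
    by (rule polyfun.coord) (force simp: payoff_coords_def image_iff)
  then show ?thesis unfolding diffB_def by (intro polyfun_diff)
qed

lemmas payoff_polyfun_intros = polyfun_diff polyfun.mult polyfun_diffA polyfun_diffB

definition mat22 :: "real \<Rightarrow> real \<Rightarrow> real \<Rightarrow> real \<Rightarrow> real^2^2" where
  "mat22 x y z w = vector [vector [x, y], vector [z, w]]"

lemma mat22_nth [simp]: "mat22 x y z w $ 1 $ 1 = x" "mat22 x y z w $ 1 $ 2 = y"
  "mat22 x y z w $ 2 $ 1 = z" "mat22 x y z w $ 2 $ 2 = w"
  by (simp_all add: mat22_def)

lemma complex_of_real_mult_eq_iff:
  "complex_of_real x * complex_of_real y = complex_of_real z * complex_of_real w \<longleftrightarrow> x * y = z * w"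
  by (simp flip: of_real_mult)

text \<open>For payoff differences \<open>a * d - b * c = (a12 - a11) * (a22 - a21)\<close>, so
  either equation splits the first quadric.\<close>

lemma generic_case_1_3:
  assumes "k = 1 \<or> k = 3" shows "generic_real_density k"
proof (rule generic_real_densityI)
  let ?g = "\<lambda>x. diffA 2 1 1 1 x * diffA 2 2 1 1 x * diffA 2 1 1 2 x * diffA 2 2 1 2 x * diffB 1 2 1 1 x
    * diffB 2 2 2 1 x * (diffB 1 2 1 1 x * diffB 2 2 2 1 x - diffB 2 2 1 1 x * diffB 1 2 2 1 x)"
  show "?g \<in> polyfun payoff_coords" by (intro payoff_polyfun_intros)
  \<comment> \<open>Distinct entries of \<open>B\<close> suffice, since the last factor of
    \<open>?g\<close> equals \<open>(b21 - b11) * (b22 - b12)\<close>.\<close>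
  show "spohn_case k (if k = 1 then mat22 0 0 1 2 else mat22 0 1 3 3) (mat22 0 1 3 7)"
    "?g (if k = 1 then mat22 0 0 1 2 else mat22 0 1 3 3, mat22 0 1 3 7) \<noteq> 0"
    using assms by (auto simp: spohn_case_def Let_def diffA_def diffB_def)
  fix A B assume *: "spohn_case k A B" "?g (A, B) \<noteq> 0"
  have "(A$2$1 - A$1$1) * (A$2$2 - A$1$2) = (A$2$2 - A$1$1) * (A$2$1 - A$1$2)"
    using *(1) assms by (auto simp: spohn_case_def)
  then show "real_rational_cone (spohn_cone A B)" unfolding spohn_cone_def
    by (intro real_rational_cone_two_conics)
      (use *(2) in \<open>auto simp: diffA_def diffB_def complex_of_real_mult_eq_iff simp del: of_real_diff\<close>)
qed

text \<open>Here \<open>e * h - f * g = (b21 - b11) * (b22 - b12)\<close>, so the second quadric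
  splits.\<close>

lemma generic_case_5_6:
  assumes "k = 5 \<or> k = 6" shows "generic_real_density k"
proof (rule generic_real_densityI)
  let ?g = "\<lambda>x. diffB 1 2 1 1 x * diffB 2 2 1 1 x * diffB 1 2 2 1 x * diffB 2 2 2 1 x * diffA 2 1 1 1 x
    * diffA 2 2 1 2 x * (diffA 2 1 1 1 x * diffA 2 2 1 2 x - diffA 2 2 1 1 x * diffA 2 1 1 2 x)"
  show "?g \<in> polyfun payoff_coords" by (intro payoff_polyfun_intros)
  show "spohn_case k (mat22 0 1 3 7) (if k = 5 then mat22 0 1 0 2 else mat22 0 3 1 3)"
    "?g (mat22 0 1 3 7, if k = 5 then mat22 0 1 0 2 else mat22 0 3 1 3) \<noteq> 0"
    using assms by (auto simp: spohn_case_def Let_def diffA_def diffB_def)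
  fix A B assume *: "spohn_case k A B" "?g (A, B) \<noteq> 0"
  have "(B$1$2 - B$1$1) * (B$2$2 - B$2$1) = (B$2$2 - B$1$1) * (B$1$2 - B$2$1)"
    using *(1) assms by (auto simp: spohn_case_def)
  then show "real_rational_cone (spohn_cone A B)" unfolding spohn_cone_def
    by (intro real_rational_cone_swap_players[OF real_rational_cone_two_conics])
      (use *(2) in \<open>auto simp: diffA_def diffB_def complex_of_real_mult_eq_iff simp del: of_real_diff\<close>)
qed

text \<open>The equation removes \<open>p$1 * p$3\<close> from the first quadric, which puts the
  line \<open>p$2 = p$4 = 0\<close> on both.\<close>

lemma generic_case_2: "generic_real_density 2"
proof (rule generic_real_densityI)
  let ?g = "\<lambda>x. diffA 2 2 1 1 x * diffA 2 1 1 2 x * diffA 2 2 1 2 x * diffB 1 2 1 1 x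
    * diffB 2 2 2 1 x * (diffB 1 2 1 1 x * diffB 2 2 2 1 x - diffB 2 2 1 1 x * diffB 1 2 2 1 x)"
  show "?g \<in> polyfun payoff_coords" by (intro payoff_polyfun_intros)
  show "spohn_case 2 (mat22 0 1 0 3) (mat22 0 1 3 7)" "?g (mat22 0 1 0 3, mat22 0 1 3 7) \<noteq> 0"
    by (auto simp: spohn_case_def Let_def diffA_def diffB_def)
  fix A B assume *: "spohn_case 2 A B" "?g (A, B) \<noteq> 0"
  then have "complex_of_real (A$2$1 - A$1$1) = 0" by (simp add: spohn_case_def)
  with * show "real_rational_cone (spohn_cone A B)" unfolding spohn_cone_def
    by (simp only:) (rule real_rational_cone_axis_line_cubic;
      auto simp: diffA_def diffB_def complex_of_real_mult_eq_iff simp del: of_real_diff)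
qed

lemma generic_case_4: "generic_real_density 4"
proof (rule generic_real_densityI)
  let ?g = "\<lambda>x. diffB 2 2 1 1 x * diffB 1 2 2 1 x * diffB 2 2 2 1 x * diffA 2 1 1 1 x
    * diffA 2 2 1 2 x * (diffA 2 1 1 1 x * diffA 2 2 1 2 x - diffA 2 2 1 1 x * diffA 2 1 1 2 x)"
  show "?g \<in> polyfun payoff_coords" by (intro payoff_polyfun_intros)
  show "spohn_case 4 (mat22 0 1 3 7) (mat22 0 0 1 3)" "?g (mat22 0 1 3 7, mat22 0 0 1 3) \<noteq> 0"
    by (auto simp: spohn_case_def Let_def diffA_def diffB_def)
  fix A B assume *: "spohn_case 4 A B" "?g (A, B) \<noteq> 0"
  then have "complex_of_real (B$1$2 - B$1$1) = 0" by (simp add: spohn_case_def)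
  with * show "real_rational_cone (spohn_cone A B)" unfolding spohn_cone_def
    by (simp only:) (rule real_rational_cone_swap_players, rule real_rational_cone_axis_line_cubic;
      auto simp: diffA_def diffB_def complex_of_real_mult_eq_iff simp del: of_real_diff)
qed

text \<open>With \<open>d = h = 0\<close> both quadrics contain the lines
  \<open>p$1 = p$3 = 0\<close> and \<open>p$1 = p$2 = 0\<close>.\<close>

lemma generic_case_7: "generic_real_density 7"
proof (rule generic_real_densityI)
  let ?g = "\<lambda>x. diffA 2 1 1 1 x * diffA 2 2 1 1 x * diffA 2 1 1 2 x * diffB 1 2 1 1 x * diffB 2 2 1 1 x
    * diffB 1 2 2 1 x * (diffA 2 2 1 1 x * diffB 1 2 2 1 x - diffA 2 1 1 2 x * diffB 2 2 1 1 x)"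
  show "?g \<in> polyfun payoff_coords" by (intro payoff_polyfun_intros)
  show "spohn_case 7 (mat22 0 1 3 1) (mat22 0 1 2 2)" "?g (mat22 0 1 3 1, mat22 0 1 2 2) \<noteq> 0"
    by (auto simp: spohn_case_def Let_def diffA_def diffB_def)
  fix A B assume *: "spohn_case 7 A B" "?g (A, B) \<noteq> 0"
  then have "complex_of_real (A$2$2 - A$1$2) = 0" "complex_of_real (B$2$2 - B$2$1) = 0"
    by (simp_all add: spohn_case_def)
  with * show "real_rational_cone (spohn_cone A B)" unfolding spohn_cone_def
    by (simp only:) (rule real_rational_cone_two_lines_conic;
      auto simp: diffA_def diffB_def complex_of_real_mult_eq_iff simp del: of_real_diff)
qed

lemma generic_case_8: "generic_real_density 8"
proof (rule generic_real_densityI)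
  let ?g = "\<lambda>x. diffA 2 1 1 1 x * diffA 2 2 1 2 x * diffB 1 2 1 1 x * diffB 2 2 2 1 x
    * (diffA 2 1 1 1 x * diffA 2 2 1 2 x * (diffB 2 2 1 1 x * diffB 2 2 1 1 x)
      - diffB 1 2 1 1 x * diffB 2 2 2 1 x * (diffA 2 2 1 1 x * diffA 2 2 1 1 x))"
  show "?g \<in> polyfun payoff_coords" by (intro payoff_polyfun_intros)
  show "spohn_case 8 (mat22 0 1 1 3) (mat22 0 1 1 4)" "?g (mat22 0 1 1 3, mat22 0 1 1 4) \<noteq> 0"
    by (auto simp: spohn_case_def Let_def diffA_def diffB_def)
  fix A B assume *: "spohn_case 8 A B" "?g (A, B) \<noteq> 0"
  then have "complex_of_real (A$2$1 - A$1$2) = 0" "complex_of_real (B$1$2 - B$2$1) = 0"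
    by (simp_all add: spohn_case_def)
  with * show "real_rational_cone (spohn_cone A B)" unfolding spohn_cone_def
    by (simp only:) (rule real_rational_cone_diagonal_line_cubic;
      auto simp: diffA_def diffB_def power2_eq_square complex_of_real_mult_eq_iff of_real_mult[symmetric]
        simp del: of_real_diff of_real_mult)
qed

text \<open>Generically \<open>B\<close> is an affine function of the transpose of \<open>A\<close>,
  so \<open>e, f, g, h\<close> are proportional to \<open>a, b, c, d\<close>. Eliminating
  \<open>p$1 * p$4\<close> also removes \<open>p$2 * p$3\<close> and leaves
  \<open>f * (a * p$1 - d * p$4) * (p$2 - p$3)\<close>.\<close>

lemma generic_case_9: "generic_real_density 9"
proof (rule generic_real_densityI)
  let ?g = "\<lambda>x. diffA 2 1 1 1 x * diffA 2 2 1 1 x * diffA 2 1 1 2 x * diffA 2 2 1 2 x * diffB 2 2 1 1 x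
    * (diffA 2 2 1 1 x * diffA 2 1 1 2 x - diffA 2 1 1 1 x * diffA 2 2 1 2 x)"
  show "?g \<in> polyfun payoff_coords" by (intro payoff_polyfun_intros)
  show "spohn_case 9 (mat22 0 1 3 7) (mat22 0 3 1 7)" "?g (mat22 0 1 3 7, mat22 0 3 1 7) \<noteq> 0"
    by (auto simp: spohn_case_def Let_def diffA_def diffB_def)
  fix A B assume *: "spohn_case 9 A B" "?g (A, B) \<noteq> 0"
  define a b c d e f g h where coeffs: "a = A$2$1 - A$1$1" "b = A$2$2 - A$1$1" "c = A$2$1 - A$1$2" "d = A$2$2 - A$1$2"
    "e = B$1$2 - B$1$1" "f = B$2$2 - B$1$1" "g = B$1$2 - B$2$1" "h = B$2$2 - B$2$1"
  have "b * e = a * f" "b * g = c * f" "b * h = d * f"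
    using *(1) unfolding spohn_case_def Let_def coeffs by (simp_all add: algebra_simps)
  then have rel: "complex_of_real b * of_real e = of_real a * of_real f"
    "complex_of_real b * of_real g = of_real c * of_real f" "complex_of_real b * of_real h = of_real d * of_real f"
    by (simp_all add: complex_of_real_mult_eq_iff)
  have nz: "a \<noteq> 0" "b \<noteq> 0" "c \<noteq> 0" "d \<noteq> 0" "f \<noteq> 0" "b * c \<noteq> a * d"
    using *(2) by (auto simp: diffA_def diffB_def coeffs)
  show "real_rational_cone (spohn_cone A B)" unfolding spohn_cone_def coeffs[symmetric]
  proof (rule real_rational_cone_pencil_two_conics[where a'="of_real a" and b'="- of_real a"
        and c'="- of_real d" and d'="of_real d"])
    fix p
    show "complex_of_real b * quad2 e f g h p - f * quad1 a b c d p
      = f * (a * p$1 * p$2 + - complex_of_real a * p$1 * p$3 + - complex_of_real d * p$4 * p$2 + d * p$4 * p$3)"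
      unfolding quad1_def quad2_def using rel by algebra
  qed (use nz in \<open>auto simp: complex_of_real_mult_eq_iff\<close>)
qed

text \<open>Generically \<open>B\<close> is an affine function of \<open>A\<close> with its diagonal
  entries exchanged, and the split member of the pencil is
  \<open>f * (p$1 - p$4) * (d * p$2 - a * p$3)\<close>.\<close>

lemma generic_case_10: "generic_real_density 10"
proof (rule generic_real_densityI)
  let ?g = "\<lambda>x. diffA 2 1 1 1 x * diffA 2 2 1 1 x * diffA 2 1 1 2 x * diffA 2 2 1 2 x * diffB 2 2 1 1 x
    * (diffA 2 2 1 1 x * diffA 2 1 1 2 x - diffA 2 1 1 1 x * diffA 2 2 1 2 x)"
  show "?g \<in> polyfun payoff_coords" by (intro payoff_polyfun_intros)
  show "spohn_case 10 (mat22 0 1 3 7) (mat22 7 1 3 0)" "?g (mat22 0 1 3 7, mat22 7 1 3 0) \<noteq> 0"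
    by (auto simp: spohn_case_def Let_def diffA_def diffB_def)
  fix A B assume *: "spohn_case 10 A B" "?g (A, B) \<noteq> 0"
  define a b c d e f g h where coeffs: "a = A$2$1 - A$1$1" "b = A$2$2 - A$1$1" "c = A$2$1 - A$1$2" "d = A$2$2 - A$1$2"
    "e = B$1$2 - B$1$1" "f = B$2$2 - B$1$1" "g = B$1$2 - B$2$1" "h = B$2$2 - B$2$1"
  have "b * e = d * f" "b * g = c * f" "b * h = a * f"
    using *(1) unfolding spohn_case_def Let_def coeffs by (simp_all add: algebra_simps)
  then have rel: "complex_of_real b * of_real e = of_real d * of_real f"
    "complex_of_real b * of_real g = of_real c * of_real f" "complex_of_real b * of_real h = of_real a * of_real f"
    by (simp_all add: complex_of_real_mult_eq_iff)
  have nz: "a \<noteq> 0" "b \<noteq> 0" "c \<noteq> 0" "d \<noteq> 0" "f \<noteq> 0" "b * c \<noteq> a * d"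
    using *(2) by (auto simp: diffA_def diffB_def coeffs)
  show "real_rational_cone (spohn_cone A B)" unfolding spohn_cone_def coeffs[symmetric]
  proof (rule real_rational_cone_pencil_two_conics[where a'="of_real d" and b'="- of_real a"
        and c'="- of_real d" and d'="of_real a"])
    fix p
    show "complex_of_real b * quad2 e f g h p - f * quad1 a b c d p
      = f * (d * p$1 * p$2 + - complex_of_real a * p$1 * p$3 + - complex_of_real d * p$4 * p$2 + a * p$4 * p$3)"
      unfolding quad1_def quad2_def using rel by algebra
  qed (use nz in \<open>auto simp: complex_of_real_mult_eq_iff\<close>)
qed

text \<open>Generically \<open>B\<close> is an affine function of \<open>A\<close>. Subtracting
  \<open>a11\<close> from \<open>A\<close> and rescaling the second quadric by \<open>f / b\<close>
  gives the normalized tables.\<close>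

lemma generic_case_11: "generic_real_density 11"
proof (rule generic_real_densityI)
  let ?g = "\<lambda>x. diffA 2 1 1 1 x * diffA 2 2 1 1 x * diffA 2 1 1 2 x * diffA 2 2 1 2 x * diffB 2 2 1 1 x
    * diffA 1 2 1 1 x * diffA 2 1 2 2 x"
  show "?g \<in> polyfun payoff_coords" by (intro payoff_polyfun_intros)
  show "spohn_case 11 (mat22 0 1 3 7) (mat22 0 1 3 7)" "?g (mat22 0 1 3 7, mat22 0 1 3 7) \<noteq> 0"
    by (auto simp: spohn_case_def Let_def diffA_def diffB_def)
  fix A B assume *: "spohn_case 11 A B" "?g (A, B) \<noteq> 0"
  define a b k e f g h where coeffs: "a = A$2$1 - A$1$1" "b = A$2$2 - A$1$1" "k = A$1$2 - A$1$1"
    "e = B$1$2 - B$1$1" "f = B$2$2 - B$1$1" "g = B$1$2 - B$2$1" "h = B$2$2 - B$2$1"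
  have cd: "A$2$1 - A$1$2 = a - k" "A$2$2 - A$1$2 = b - k" by (auto simp: coeffs)
  have "b * e = k * f" "b * g = (k - a) * f" "b * h = (b - a) * f"
    using *(1) unfolding spohn_case_def Let_def coeffs by (simp_all add: algebra_simps)
  then have rel: "complex_of_real b * of_real e = of_real k * of_real f"
    "complex_of_real b * of_real g = (of_real k - of_real a) * of_real f"
    "complex_of_real b * of_real h = (of_real b - of_real a) * of_real f"
    by (simp_all add: complex_of_real_mult_eq_iff flip: of_real_diff)
  have nz: "a \<noteq> 0" "b \<noteq> 0" "k \<noteq> 0" "a \<noteq> b" "a \<noteq> k" "b \<noteq> k" "f \<noteq> 0"
    using *(2) by (auto simp: diffA_def diffB_def coeffs)
  have "quad_cone a b (complex_of_real a - k) (complex_of_real b - k) e f g h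
    = quad_cone a b (complex_of_real a - k) (complex_of_real b - k) k b (complex_of_real k - a) (complex_of_real b - a)"
  proof (rule quad_cone_cong_second)
    show "complex_of_real b * quad2 e f g h p
      = complex_of_real f * quad2 k b (complex_of_real k - a) (complex_of_real b - a) p" for p
      unfolding quad2_def using rel by algebra
  qed (use nz in auto)
  moreover have "real_rational_cone \<dots>"
    by (rule real_rational_cone_proportional_payoffs) (use nz in auto)
  ultimately show "real_rational_cone (spohn_cone A B)"
    unfolding spohn_cone_def cd coeffs(1,2,4-7)[symmetric] by simp
qed

text \<open>Generically \<open>B\<close> is an affine function of \<open>A\<close> turned by 180
  degrees; the proportionality factor is \<open>- f / b\<close>.\<close>

lemma generic_case_12: "generic_real_density 12"
proof (rule generic_real_densityI)
  let ?g = "\<lambda>x. diffA 2 1 1 1 x * diffA 2 2 1 1 x * diffA 2 1 1 2 x * diffA 2 2 1 2 x * diffB 2 2 1 1 x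
    * diffA 1 2 1 1 x * diffA 2 1 2 2 x"
  show "?g \<in> polyfun payoff_coords" by (intro payoff_polyfun_intros)
  show "spohn_case 12 (mat22 0 1 3 7) (mat22 7 3 1 0)" "?g (mat22 0 1 3 7, mat22 7 3 1 0) \<noteq> 0"
    by (auto simp: spohn_case_def Let_def diffA_def diffB_def)
  fix A B assume *: "spohn_case 12 A B" "?g (A, B) \<noteq> 0"
  define a b k e f g h where coeffs: "a = A$2$1 - A$1$1" "b = A$2$2 - A$1$1" "k = A$1$2 - A$1$1"
    "e = B$1$2 - B$1$1" "f = B$2$2 - B$1$1" "g = B$1$2 - B$2$1" "h = B$2$2 - B$2$1"
  have cd: "A$2$1 - A$1$2 = a - k" "A$2$2 - A$1$2 = b - k" by (auto simp: coeffs)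
  have "b * e = (b - a) * f" "b * g = (k - a) * f" "b * h = k * f"
    using *(1) unfolding spohn_case_def Let_def coeffs by (simp_all add: algebra_simps)
  then have rel: "complex_of_real b * of_real h = of_real k * of_real f"
    "complex_of_real b * of_real g = (of_real k - of_real a) * of_real f"
    "complex_of_real b * of_real e = (of_real b - of_real a) * of_real f"
    by (simp_all add: complex_of_real_mult_eq_iff flip: of_real_diff)
  have nz: "a \<noteq> 0" "b \<noteq> 0" "k \<noteq> 0" "a \<noteq> b" "a \<noteq> k" "b \<noteq> k" "f \<noteq> 0"
    using *(2) by (auto simp: diffA_def diffB_def coeffs)
  have "quad_cone a b (complex_of_real a - k) (complex_of_real b - k) e f g h
    = quad_cone a b (complex_of_real a - k) (complex_of_real b - k) (complex_of_real a - b) (- complex_of_real b)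
        (complex_of_real a - k) (- complex_of_real k)"
  proof (rule quad_cone_cong_second)
    show "complex_of_real b * quad2 e f g h p = - complex_of_real f *
      quad2 (complex_of_real a - b) (- complex_of_real b) (complex_of_real a - k) (- complex_of_real k) p" for p
      unfolding quad2_def using rel by algebra
  qed (use nz in auto)
  moreover have "real_rational_cone \<dots>"
    by (rule real_rational_cone_rotated_payoffs) (use nz in auto)
  ultimately show "real_rational_cone (spohn_cone A B)"
    unfolding spohn_cone_def cd coeffs(1,2,4-7)[symmetric] by simp
qed

theorem theorem3p7:
  fixes k :: nat
  assumes "k \<in> {1..12}"
  shows "\<exists>Z. zclosed payoff_coords Z \<and> \<not> case_variety k \<subseteq> Z \<and>
     (\<forall>A B. (A, B) \<in> case_variety k - Z \<longrightarrow>
        (\<forall>Y. pcomponent (spohn_variety A B) Y \<longrightarrow>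
              (\<exists>x\<in>Y. real_ppoint x \<and> psmooth (spohn_variety A B) x)) \<and>
        pclosure {x \<in> spohn_variety A B. real_ppoint x} = spohn_variety A B)"
proof -
  have "k = 1 \<or> k = 2 \<or> k = 3 \<or> k = 4 \<or> k = 5 \<or> k = 6 \<or> k = 7 \<or> k = 8 \<or> k = 9 \<or> k = 10 \<or> k = 11 \<or> k = 12"
    using assms unfolding atLeastAtMost_iff by presburger
  then have "generic_real_density k"
    by (elim disjE) (simp_all add: generic_case_1_3 generic_case_5_6 generic_case_2 generic_case_4 generic_case_7
        generic_case_8 generic_case_9 generic_case_10 generic_case_11 generic_case_12)
  then show ?thesis unfolding generic_real_density_def .
qed

end
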